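(* Let $q\in\mathrm{SL}(2)$. The exponential map $\exp_q : T^*_q(\mathrm{SL}(2)) \to \mathrm{SL}(2)$ fails to be injective in any neighbourhood of any conjugate covector $\lambda_0 \in \mathrm{Conj}_q(\mathrm{SL}(2))$.
   Context: $\mathrm{SL}(2)$ is the group of real $2\times2$ matrices of determinant $1$. Let $X_0 = \frac12\begin{pmatrix} 0 & -1\\ 1& 0\end{pmatrix}$, $X_1 = \frac12\begin{pmatrix} 1 & 0\\ 0& -1\end{pmatrix}$, $X_2 = \frac12\begin{pmatrix} 0 & 1\\ 1& 0\end{pmatrix}$ be the basis of $\mathfrak{sl}(2)$, regarded as left-invariant vector fields. The sub-Riemannian structure on $\mathrm{SL}(2)$ is the left-invariant one with distribution spanned by $X_1,X_2$ and metric making $X_1,X_2$ orthonormal. Its Hamiltonian is $H(q,\lambda)=\frac12(\langle\lambda,X_1(q)\rangle^2+\langle\lambda,X_2(q)\rangle^2)$ on $T^*(\mathrm{SL}(2))$. The exponential map is $\exp_q(\lambda_0)=\pi(e^{\vec H}(q,\lambda_0))$, where $e^{t\vec H}$ is the Hamiltonian flow of $H$ and $\pi:T^*(\mathrm{SL}(2))\to\mathrm{SL}(2)$ is the bundle projection; it is defined on all of $T_q^*(\mathrm{SL}(2))$. The conjugate locus is $\mathrm{Conj}_q(\mathrm{SL}(2))=\{\lambda_0\in T^*_q(\mathrm{SL}(2)) : \mathrm{Ker}(d_{\lambda_0}\exp_q)\neq\{0\}\}$, and its elements are called conjugate covectors. *)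

theory Defs
  imports "HOL-Analysis.Analysis"
begin

text \<open>
  The manifolds involved are embedded in Euclidean spaces. Their tangent vectors are velocities
  of curves.
\<close>

definition tangent_space :: "'a::real_normed_vector set \<Rightarrow> 'a \<Rightarrow> 'a set" where
  "tangent_space M x =
     {v. \<exists>\<gamma>::real \<Rightarrow> 'a. \<gamma> 0 = x \<and> (\<forall>t. \<gamma> t \<in> M) \<and> (\<gamma> has_vector_derivative v) (at 0)}"

text \<open>
  A covector at \<open>x\<close> is a linear functional on the tangent space at \<open>x\<close>. It is represented by the
  unique tangent vector \<open>p\<close> at \<open>x\<close> such that the functional is \<open>v \<mapsto> p \<bullet> v\<close>, with the
  ambient Euclidean inner product. So the pairing of a covector with a tangent vector is the
  inner product, and the cotangent spaces are linear subspaces of the ambient space. The choice of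
  inner product is only a way of encoding functionals; it is unrelated to the sub-Riemannian metric.
\<close>

definition cotangent_space :: "'a::euclidean_space set \<Rightarrow> 'a \<Rightarrow> 'a set" where
  "cotangent_space M x = tangent_space M x"

definition cotangent_bundle :: "'a::euclidean_space set \<Rightarrow> ('a \<times> 'a) set" where
  "cotangent_bundle M = {(x, p). x \<in> M \<and> p \<in> cotangent_space M x}"

text \<open>
  With this representation the tautological one-form of the cotangent bundle of \<open>M\<close>, which at
  \<open>(x, p)\<close> sends \<open>(v, w)\<close> to \<open>p \<bullet> v\<close>, is the restriction of the one-form \<open>p dx\<close> of the ambient
  space. Its exterior derivative, the canonical symplectic form, is therefore the restriction of
  \<open>dp \<and> dx\<close> to the tangent spaces of the bundle.
\<close>

definition symplectic_form :: "'a::euclidean_space \<times> 'a \<Rightarrow> 'a \<times> 'a \<Rightarrow> real" where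
  "symplectic_form \<eta> \<xi> = snd \<eta> \<bullet> fst \<xi> - snd \<xi> \<bullet> fst \<eta>"

text \<open>
  A Hamiltonian is given by a differentiable function on the ambient space; only its restriction
  to the cotangent bundle matters, since its differential is only applied to vectors tangent to
  the bundle. The sign is such that Hamilton's equations in \<open>\<real>\<^sup>n\<close> are
  \<open>x' = \<partial>H/\<partial>p\<close>, \<open>p' = - \<partial>H/\<partial>x\<close>.
\<close>

definition hamiltonian_field ::
  "'a::euclidean_space set \<Rightarrow> ('a \<times> 'a \<Rightarrow> real) \<Rightarrow> 'a \<times> 'a \<Rightarrow> 'a \<times> 'a" where
  "hamiltonian_field M H z =
     (THE \<xi>. \<xi> \<in> tangent_space (cotangent_bundle M) z \<and>
        (\<forall>\<eta> \<in> tangent_space (cotangent_bundle M) z.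
           symplectic_form \<eta> \<xi> = frechet_derivative H (at z) \<eta>))"

definition hamiltonian_flow ::
  "'a::euclidean_space set \<Rightarrow> ('a \<times> 'a \<Rightarrow> real) \<Rightarrow> real \<Rightarrow> 'a \<times> 'a \<Rightarrow> 'a \<times> 'a" where
  "hamiltonian_flow M H t z =
     (THE \<gamma>. \<gamma> 0 = z \<and> (\<forall>s. \<gamma> s \<in> cotangent_bundle M \<and>
        (\<gamma> has_vector_derivative hamiltonian_field M H (\<gamma> s)) (at s))) t"

definition SL2 :: "(real^2^2) set" where
  "SL2 = {q. det q = 1}"

definition X1 :: "real^2^2 \<Rightarrow> real^2^2" where
  "X1 q = q ** ((1/2) *\<^sub>R vector [vector [1, 0], vector [0, -1]])"

definition X2 :: "real^2^2 \<Rightarrow> real^2^2" where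
  "X2 q = q ** ((1/2) *\<^sub>R vector [vector [0, 1], vector [1, 0]])"

text \<open>
  The sub-Riemannian Hamiltonian of the left-invariant structure with orthonormal frame
  \<open>X1\<close>, \<open>X2\<close>.
\<close>

definition sr_hamiltonian :: "(real^2^2) \<times> (real^2^2) \<Rightarrow> real" where
  "sr_hamiltonian = (\<lambda>(q, p). ((p \<bullet> X1 q)\<^sup>2 + (p \<bullet> X2 q)\<^sup>2) / 2)"

definition sr_exp :: "real^2^2 \<Rightarrow> real^2^2 \<Rightarrow> real^2^2" where
  "sr_exp q p = fst (hamiltonian_flow SL2 sr_hamiltonian 1 (q, p))"

text \<open>
  Since the cotangent space at \<open>q\<close> is a proper linear subspace of the ambient space, a
  derivative within it is determined only on that subspace, which is where its kernel is taken.
\<close>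

definition conjugate_locus :: "real^2^2 \<Rightarrow> (real^2^2) set" where
  "conjugate_locus q =
     {p \<in> cotangent_space SL2 q.
        \<exists>D. (sr_exp q has_derivative D) (at p within cotangent_space SL2 q) \<and>
            (\<exists>v \<in> cotangent_space SL2 q. v \<noteq> 0 \<and> D v = 0)}"

end

theory Submission
  imports Defs
begin

text \<open>
  In the left-invariant coordinates \<open>k = h\<^sub>0/2\<close>, \<open>a = h\<^sub>1/2\<close>, \<open>b = h\<^sub>2/2\<close> of a covector at \<open>q\<close>, the
  geodesics are \<open>q exp(t A) R(k t)\<close>, where \<open>A = h\<^sub>1 X\<^sub>1 + h\<^sub>2 X\<^sub>2 - h\<^sub>0 X\<^sub>0\<close> satisfies \<open>A\<^sup>2 = x\<close> with
  \<open>x = a\<^sup>2 + b\<^sup>2 - k\<^sup>2\<close>, and \<open>R\<close> denotes rotations. Write \<open>C = cosh (sqrt x)\<close> and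
  \<open>S = sinh (sqrt x) / sqrt x\<close>, and split matrices into their complex linear and antilinear parts.
  The end point at time 1, translated to the identity, has the components \<open>\<alpha> = (C - i k S) e\<^sup>i\<^sup>k\<close> and
  \<open>\<beta> = S (a + i b) e\<^sup>-\<^sup>i\<^sup>k\<close>. Its differential is singular only if \<open>a = b = 0\<close>, \<open>S = 0\<close> or \<open>S' = 0\<close>.
  In the first case the end point is independent of \<open>k\<close>, in the second it is unchanged by rotations
  of \<open>(a, b)\<close>. In the third, \<open>x = - \<tau>\<^sup>2\<close> with \<open>sin \<tau> = \<tau> cos \<tau>\<close>. Fix \<open>\<beta>\<close> and let \<open>\<tau>\<close> vary: this
  is a curve of covectors along which only the argument of \<open>\<alpha>\<close> changes, and its derivative is a
  nonvanishing multiple of \<open>sin \<tau> - \<tau> cos \<tau>\<close>. The latter changes sign at the conjugate covector, so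
  the argument takes some values twice in every neighbourhood.
\<close>

subsection \<open>Real matrices of order two\<close>

definition mat2 :: "real \<Rightarrow> real \<Rightarrow> real \<Rightarrow> real \<Rightarrow> real^2^2" where
  "mat2 a b c d = vector [vector [a, b], vector [c, d]]"

lemma mat2_nth [simp]:
  "mat2 a b c d $ 1 $ 1 = a" "mat2 a b c d $ 1 $ 2 = b"
  "mat2 a b c d $ 2 $ 1 = c" "mat2 a b c d $ 2 $ 2 = d"
  by (simp_all add: mat2_def)

lemma mat2_eta: "mat2 (x $ 1 $ 1) (x $ 1 $ 2) (x $ 2 $ 1) (x $ 2 $ 2) = x"
  by (simp add: vec_eq_iff forall_2)

lemma mat2_cases: obtains a b c d where "x = mat2 a b c d"
  by (metis mat2_eta)

lemma mat2_eq_iff [simp]: "mat2 a b c d = mat2 a' b' c' d' \<longleftrightarrow> a = a' \<and> b = b' \<and> c = c' \<and> d = d'"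
  by (auto simp add: vec_eq_iff forall_2)

lemma mat2_arith [simp]:
  "mat2 a b c d + mat2 a' b' c' d' = mat2 (a + a') (b + b') (c + c') (d + d')"
  "mat2 a b c d - mat2 a' b' c' d' = mat2 (a - a') (b - b') (c - c') (d - d')"
  "- mat2 a b c d = mat2 (- a) (- b) (- c) (- d)"
  "r *\<^sub>R mat2 a b c d = mat2 (r * a) (r * b) (r * c) (r * d)"
  "mat2 a b c d ** mat2 a' b' c' d' =
     mat2 (a * a' + b * c') (a * b' + b * d') (c * a' + d * c') (c * b' + d * d')"
  "mat2 a b c d \<bullet> mat2 a' b' c' d' = a * a' + b * b' + c * c' + d * d'"
  "det (mat2 a b c d) = a * d - b * c"
  by (simp_all add: vec_eq_iff forall_2 sum_2 matrix_matrix_mult_def inner_vec_def det_2)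

lemma mat2_zero: "0 = mat2 0 0 0 0" and mat2_one: "mat 1 = mat2 1 0 0 1"
  by (simp_all add: vec_eq_iff forall_2 mat_def)

lemma mat2_eq_0_iff [simp]: "mat2 a b c d = 0 \<longleftrightarrow> a = 0 \<and> b = 0 \<and> c = 0 \<and> d = 0"
  by (simp add: mat2_zero)

lemma X_mat2:
  "X1 q = q ** mat2 (1/2) 0 0 (-1/2)" "X2 q = q ** mat2 0 (1/2) (1/2) 0"
  by (simp_all add: X1_def X2_def mat2_def[symmetric])

section \<open>Differentiation of matrix-valued curves\<close>

lemma has_vector_derivative_mat2_iff:
  "(f has_vector_derivative mat2 a b c d) F \<longleftrightarrow>
     ((\<lambda>t. f t $ 1 $ 1) has_vector_derivative a) F \<and> ((\<lambda>t. f t $ 1 $ 2) has_vector_derivative b) F \<and>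
     ((\<lambda>t. f t $ 2 $ 1) has_vector_derivative c) F \<and> ((\<lambda>t. f t $ 2 $ 2) has_vector_derivative d) F"
    (is "?L \<longleftrightarrow> ?R")
proof
  assume L: ?L
  have *: "bounded_linear (\<lambda>m::real^2^2. m $ i $ j)" for i j
    using bounded_linear_compose[OF bounded_linear_vec_nth bounded_linear_vec_nth] by fastforce
  show ?R
    using bounded_linear.has_vector_derivative[OF * L, of 1 1] bounded_linear.has_vector_derivative[OF * L, of 1 2]
      bounded_linear.has_vector_derivative[OF * L, of 2 1] bounded_linear.has_vector_derivative[OF * L, of 2 2]
    by simp
next
  assume R: ?R
  have "((\<lambda>t. (f t $ 1 $ 1) *\<^sub>R mat2 1 0 0 0 + (f t $ 1 $ 2) *\<^sub>R mat2 0 1 0 0 +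
      (f t $ 2 $ 1) *\<^sub>R mat2 0 0 1 0 + (f t $ 2 $ 2) *\<^sub>R mat2 0 0 0 1) has_vector_derivative
     a *\<^sub>R mat2 1 0 0 0 + b *\<^sub>R mat2 0 1 0 0 + c *\<^sub>R mat2 0 0 1 0 + d *\<^sub>R mat2 0 0 0 1) F"
    using R by (intro has_vector_derivative_add
        bounded_linear.has_vector_derivative[OF bounded_linear_scaleR_left]) auto
  then show ?L by (simp add: mat2_eta)
qed

lemma has_vector_derivative_mat2:
  assumes "(a has_real_derivative a') (at t)" "(b has_real_derivative b') (at t)"
    "(c has_real_derivative c') (at t)" "(d has_real_derivative d') (at t)"
  shows "((\<lambda>t. mat2 (a t) (b t) (c t) (d t)) has_vector_derivative mat2 a' b' c' d') (at t)"
  using assms by (simp add: has_vector_derivative_mat2_iff has_real_derivative_iff_has_vector_derivative)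

lemma has_vector_derivative_matrix_mult:
  fixes f g :: "real \<Rightarrow> real^2^2"
  assumes "(f has_vector_derivative f') (at t)" "(g has_vector_derivative g') (at t)"
  shows "((\<lambda>t. f t ** g t) has_vector_derivative f' ** g t + f t ** g') (at t)"
proof -
  obtain a b c d where f': "f' = mat2 a b c d" by (rule mat2_cases)
  obtain a2 b2 c2 d2 where g': "g' = mat2 a2 b2 c2 d2" by (rule mat2_cases)
  have nth: "(x ** y) $ i $ j = x $ i $ 1 * y $ 1 $ j + x $ i $ 2 * y $ 2 $ j" for x y :: "real^2^2" and i j
    by (simp add: matrix_matrix_mult_def sum_2)
  have *: "f' ** g t + f t ** g' = mat2 ((f' ** g t + f t ** g') $ 1 $ 1) ((f' ** g t + f t ** g') $ 1 $ 2)
     ((f' ** g t + f t ** g') $ 2 $ 1) ((f' ** g t + f t ** g') $ 2 $ 2)"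
    by (rule mat2_eta[symmetric])
  show ?thesis
    by (subst *, subst has_vector_derivative_mat2_iff)
      (use assms in \<open>auto simp: nth f' g' has_vector_derivative_mat2_iff
          has_real_derivative_iff_has_vector_derivative[symmetric] intro!: derivative_eq_intros\<close>)
qed

text \<open>The gradient of \<open>det\<close> at \<open>x\<close>, hence a normal vector of SL(2).
  In order two it is linear in \<open>x\<close>, so it commutes with differentiation of curves. It
  preserves products, whereas its transpose \<open>adj\<close> reverses them.\<close>

definition cof :: "real^2^2 \<Rightarrow> real^2^2" where
  "cof x = mat2 (x $ 2 $ 2) (- (x $ 2 $ 1)) (- (x $ 1 $ 2)) (x $ 1 $ 1)"

definition adj :: "real^2^2 \<Rightarrow> real^2^2" where
  "adj x = mat2 (x $ 2 $ 2) (- (x $ 1 $ 2)) (- (x $ 2 $ 1)) (x $ 1 $ 1)"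

lemma cof_mat2 [simp]: "cof (mat2 a b c d) = mat2 d (- c) (- b) a"
  by (simp add: cof_def)

lemma adj_mat2 [simp]: "adj (mat2 a b c d) = mat2 d (- b) (- c) a"
  by (simp add: adj_def)

lemma bounded_linear_cof: "bounded_linear cof" and bounded_linear_adj: "bounded_linear adj"
  by (auto simp: cof_def adj_def intro!: linear_conv_bounded_linear[THEN iffD1] linearI)

declare det_mul [simp]

lemma adj_mult: "adj x ** x = det x *\<^sub>R mat 1" "x ** adj x = det x *\<^sub>R mat 1"
  by (cases x rule: mat2_cases, simp add: mat2_one algebra_simps)+

lemma has_real_derivative_det:
  assumes "(x has_vector_derivative x') (at t)"
  shows "((\<lambda>t. det (x t)) has_real_derivative x' \<bullet> cof (x t)) (at t)"
proof -
  obtain a b c d where x': "x' = mat2 a b c d" by (rule mat2_cases)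
  show ?thesis
    using assms unfolding x' det_2 cof_def has_vector_derivative_mat2_iff
      has_real_derivative_iff_has_vector_derivative[symmetric]
    by (auto intro!: derivative_eq_intros simp: algebra_simps)
qed

lemma has_real_derivative_inner:
  fixes f g :: "real \<Rightarrow> 'a::real_inner"
  assumes "(f has_vector_derivative f') (at t)" "(g has_vector_derivative g') (at t)"
  shows "((\<lambda>t. f t \<bullet> g t) has_real_derivative f' \<bullet> g t + f t \<bullet> g') (at t)"
  using bounded_bilinear.has_vector_derivative[OF bounded_bilinear_inner assms]
  by (simp add: has_real_derivative_iff_has_vector_derivative add.commute)

lemma has_vector_derivative_zero_imp_const:
  fixes f :: "real \<Rightarrow> 'a::real_normed_vector"
  assumes "\<And>t. (f has_vector_derivative 0) (at t)"
  shows "f t = f 0"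
  by (rule has_vector_derivative_zero_constant[of UNIV f, elim_format]) (use assms in auto)

subsection \<open>One-parameter groups in SL(2)\<close>

text \<open>
  The entire functions \<open>cosh (sqrt x)\<close> and \<open>sinh (sqrt x) / sqrt x\<close>, and the derivative of the
  latter. Power series avoid a case distinction at \<open>x = 0\<close>.
\<close>

definition cosh_sqrt :: "real \<Rightarrow> real" where
  "cosh_sqrt x = (\<Sum>n. 1 / fact (2 * n) * x ^ n)"

definition sinhc_sqrt :: "real \<Rightarrow> real" where
  "sinhc_sqrt x = (\<Sum>n. 1 / fact (2 * n + 1) * x ^ n)"

definition sinhc_sqrt' :: "real \<Rightarrow> real" where
  "sinhc_sqrt' x = (\<Sum>n. diffs (\<lambda>n. 1 / fact (2 * n + 1)) n * x ^ n)"

text \<open>Both series are dominated by the exponential series, since \<open>fact n\<close> is a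
  lower bound for the denominators.\<close>

lemma summable_fact_double:
  fixes x :: real
  shows "summable (\<lambda>n. 1 / fact (2 * n) * x ^ n)" (is "summable ?f")
    and "summable (\<lambda>n. 1 / fact (2 * n + 1) * x ^ n)" (is "summable ?g")
proof -
  have s: "summable (\<lambda>n. norm (1 / fact n * x ^ n))"
    using summable_norm_exp[of x] by (simp add: scaleR_conv_of_real field_simps)
  have f: "(fact n :: real) \<le> fact (2 * n)" "(fact n :: real) \<le> fact (2 * n + 1)" for n
    by (rule fact_mono, simp)+
  have "norm (1 / fact (2 * n) * x ^ n) \<le> norm (1 / fact n * x ^ n)"
    "norm (1 / fact (2 * n + 1) * x ^ n) \<le> norm (1 / fact n * x ^ n)" for n
    unfolding norm_mult
    by (rule mult_right_mono; use f[of n] in \<open>simp add: frac_le del: fact_Suc\<close>)+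
  then show "summable ?f" "summable ?g"
    by (intro summable_comparison_test[OF _ s] exI[of _ 0] allI impI; blast)+
qed

lemma diffs_fact_double: "diffs (\<lambda>n. 1 / fact (2 * n)) = (\<lambda>n. 1 / fact (2 * n + 1) / 2 :: real)"
proof
  fix n
  have "(fact (2 * Suc n) :: real) = 2 * real (Suc n) * fact (2 * n + 1)"
    by (simp add: algebra_simps)
  then show "diffs (\<lambda>n. 1 / fact (2 * n)) n = (1 / fact (2 * n + 1) / 2 :: real)"
    unfolding diffs_def by (simp add: divide_simps del: fact_Suc)
qed

lemma DERIV_cosh_sqrt: "(cosh_sqrt has_real_derivative sinhc_sqrt x / 2) (at x)"
proof -
  have "(cosh_sqrt has_real_derivative (\<Sum>n. diffs (\<lambda>n. 1 / fact (2 * n)) n * x ^ n)) (at x)"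
    unfolding cosh_sqrt_def[abs_def] by (rule termdiffs_strong_converges_everywhere) (rule summable_fact_double)
  also have "(\<Sum>n. diffs (\<lambda>n. 1 / fact (2 * n)) n * x ^ n) = sinhc_sqrt x / 2"
    unfolding diffs_fact_double sinhc_sqrt_def
    using suminf_divide[OF summable_fact_double(2)[of x], of 2] by simp
  finally show ?thesis .
qed

lemma DERIV_sinhc_sqrt: "(sinhc_sqrt has_real_derivative sinhc_sqrt' x) (at x)"
  unfolding sinhc_sqrt_def[abs_def] sinhc_sqrt'_def
  by (rule termdiffs_strong_converges_everywhere) (rule summable_fact_double)

lemma summable_sinhc_sqrt': "summable (\<lambda>n. diffs (\<lambda>n. 1 / fact (2 * n + 1)) n * (x::real) ^ n)"
  by (rule termdiff_converges_all) (rule summable_fact_double)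

text \<open>By comparison of coefficients: the constant terms on the right cancel. Keeping the
  factor \<open>x\<close> on the left lets the formula hold at \<open>x = 0\<close> as well.\<close>

lemma sinhc_sqrt'_mult: "2 * x * sinhc_sqrt' x = cosh_sqrt x - sinhc_sqrt x"
proof -
  define c :: "nat \<Rightarrow> real" where "c n = 1 / fact (2 * n) - 1 / fact (2 * n + 1)" for n
  have c: "c (Suc n) = 2 * diffs (\<lambda>n. 1 / fact (2 * n + 1)) n" for n
  proof -
    have "(fact (2 * Suc n + 1) :: real) = (2 * real (Suc n) + 1) * fact (2 * Suc n)"
      by (simp add: algebra_simps)
    then have "c (Suc n) = (2 * real (Suc n)) / fact (2 * Suc n + 1)"
      unfolding c_def by (simp add: divide_simps del: fact_Suc) 
    then show ?thesis
      unfolding diffs_def by (simp del: fact_Suc)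
  qed
  have sc: "summable (\<lambda>n. c n * x ^ n)"
    and e: "(\<Sum>n. c n * x ^ n) = cosh_sqrt x - sinhc_sqrt x"
    using summable_diff[OF summable_fact_double[of x]] suminf_diff[OF summable_fact_double[of x]]
    by (simp_all add: c_def cosh_sqrt_def sinhc_sqrt_def left_diff_distrib)
  have "(\<Sum>n. c n * x ^ n) = (\<Sum>n. c (Suc n) * x ^ Suc n)"
    using suminf_split_head[OF sc] by (simp add: c_def)
  also have "\<dots> = (\<Sum>n. (2 * x) * (diffs (\<lambda>n. 1 / fact (2 * n + 1)) n * x ^ n))"
    unfolding c by (simp add: mult_ac)
  also have "\<dots> = 2 * x * sinhc_sqrt' x"
    unfolding sinhc_sqrt'_def by (rule suminf_mult[OF summable_sinhc_sqrt'])
  finally show ?thesis using e by simp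
qed

lemma cosh_sqrt_0 [simp]: "cosh_sqrt 0 = 1" and sinhc_sqrt_0 [simp]: "sinhc_sqrt 0 = 1"
  using powser_zero[of "\<lambda>n. 1 / fact (2 * n) :: real"] powser_zero[of "\<lambda>n. 1 / fact (2 * n + 1) :: real"]
  by (simp_all add: cosh_sqrt_def sinhc_sqrt_def)

text \<open>All coefficients are positive. Hence a zero of \<open>sinhc_sqrt'\<close> is negative,
  which makes the parameter \<tau> of the fold real.\<close>

lemma sinhc_sqrt'_pos: "0 \<le> x \<Longrightarrow> 0 < sinhc_sqrt' x"
  unfolding sinhc_sqrt'_def
  \<comment> \<open>At \<open>x = 0\<close> only the term of index 0 is positive.\<close>
  by (rule suminf_pos2[where i = 0, OF summable_sinhc_sqrt'])
    (auto simp: diffs_def simp del: fact_Suc)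

lemma cosh_sqrt_minus_square: "cosh_sqrt (- \<tau>\<^sup>2) = cos \<tau>"
  using cos_paired[of \<tau>] unfolding cosh_sqrt_def
  by (simp add: sums_iff power_minus[of "\<tau>\<^sup>2"] power_mult)

lemma sinhc_sqrt_minus_square: "\<tau> * sinhc_sqrt (- \<tau>\<^sup>2) = sin \<tau>"
proof -
  have "\<tau> * sinhc_sqrt (- \<tau>\<^sup>2) = (\<Sum>n. \<tau> * (1 / fact (2 * n + 1) * (- \<tau>\<^sup>2) ^ n))"
    unfolding sinhc_sqrt_def by (rule suminf_mult[OF summable_fact_double(2), symmetric])
  also have "\<dots> = sin \<tau>"
    using sin_paired[of \<tau>]
    by (simp add: sums_iff power_minus[of "\<tau>\<^sup>2"] power_mult[of \<tau> 2] mult.left_commute[of \<tau>] mult.commute[of \<tau>] mult.assoc del: fact_Suc)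
  finally show ?thesis .
qed

text \<open>The derivative of the left side is \<open>S * (C - S - 2 * x * S')\<close>, which
  vanishes by \<open>sinhc_sqrt'_mult\<close>; the constant is the value at 0.\<close>

lemma cosh_sqrt_pythagoras: "(cosh_sqrt x)\<^sup>2 - x * (sinhc_sqrt x)\<^sup>2 = 1"
proof -
  have "((\<lambda>x. (cosh_sqrt x)\<^sup>2 - x * (sinhc_sqrt x)\<^sup>2) has_vector_derivative 0) (at x)" for x
    unfolding has_real_derivative_iff_has_vector_derivative[symmetric]
    by (auto intro!: derivative_eq_intros DERIV_cosh_sqrt DERIV_sinhc_sqrt)
      (use sinhc_sqrt'_mult[of x] in algebra)
  from has_vector_derivative_zero_imp_const[OF this, of x] show ?thesis by simp
qed

text \<open>The exponential of \<open>t A\<close> for \<open>A\<close> of trace zero, where \<open>A\<^sup>2 = - det A\<close>.\<close>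

definition exp_sl2 :: "real \<Rightarrow> real^2^2 \<Rightarrow> real^2^2" where
  "exp_sl2 t A = cosh_sqrt (- det A * t\<^sup>2) *\<^sub>R mat 1 + (t * sinhc_sqrt (- det A * t\<^sup>2)) *\<^sub>R A"

lemma exp_sl2_mat2:
  "exp_sl2 t (mat2 a b c (- a)) =
    mat2 (cosh_sqrt ((a\<^sup>2 + b * c) * t\<^sup>2) + t * sinhc_sqrt ((a\<^sup>2 + b * c) * t\<^sup>2) * a)
         (t * sinhc_sqrt ((a\<^sup>2 + b * c) * t\<^sup>2) * b)
         (t * sinhc_sqrt ((a\<^sup>2 + b * c) * t\<^sup>2) * c)
         (cosh_sqrt ((a\<^sup>2 + b * c) * t\<^sup>2) - t * sinhc_sqrt ((a\<^sup>2 + b * c) * t\<^sup>2) * a)"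
  by (simp add: exp_sl2_def mat2_one power2_eq_square add.commute)

lemma exp_sl2_0 [simp]: "exp_sl2 0 A = mat 1"
  by (simp add: exp_sl2_def)

lemma det_exp_sl2: "det (exp_sl2 t (mat2 a b c (- a))) = 1"
  using cosh_sqrt_pythagoras[of "(a\<^sup>2 + b * c) * t\<^sup>2"]
  by (simp add: exp_sl2_mat2 power2_eq_square algebra_simps)

text \<open>The coefficients of \<open>mat 1\<close> and \<open>A\<close> have the derivatives
  \<open>t * x * S\<close> and \<open>C\<close>. As \<open>A ** A\<close> is \<open>x\<close> times
  the identity, this is multiplication by \<open>A\<close>.\<close>

lemma has_vector_derivative_exp_sl2:
  assumes "A = mat2 a b c (- a)"
  shows "((\<lambda>t. exp_sl2 t A) has_vector_derivative exp_sl2 t A ** A) (at t)"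
proof -
  define x where "x = a\<^sup>2 + b * c"
  have dC: "((\<lambda>t. cosh_sqrt (x * t\<^sup>2)) has_real_derivative t * x * sinhc_sqrt (x * t\<^sup>2)) (at t)"
    by (rule DERIV_chain2[OF DERIV_cosh_sqrt, of "\<lambda>t. x * t\<^sup>2", THEN DERIV_cong])
      (auto intro!: derivative_eq_intros)
  have dS: "((\<lambda>t. t * sinhc_sqrt (x * t\<^sup>2)) has_real_derivative cosh_sqrt (x * t\<^sup>2)) (at t)"
    by (rule DERIV_cong[OF DERIV_mult[OF DERIV_ident DERIV_chain2[OF DERIV_sinhc_sqrt, of "\<lambda>t. x * t\<^sup>2"]]])
      (auto intro!: derivative_eq_intros, use sinhc_sqrt'_mult[of "x * t\<^sup>2"] in \<open>simp add: power2_eq_square algebra_simps\<close>)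
  have e: "exp_sl2 t A ** A = mat2 (t * x * sinhc_sqrt (x * t\<^sup>2) + cosh_sqrt (x * t\<^sup>2) * a)
     (cosh_sqrt (x * t\<^sup>2) * b) (cosh_sqrt (x * t\<^sup>2) * c) (t * x * sinhc_sqrt (x * t\<^sup>2) - cosh_sqrt (x * t\<^sup>2) * a)"
    unfolding assms exp_sl2_mat2 x_def[symmetric]
    by (simp add: x_def power2_eq_square algebra_simps)
  show ?thesis
    unfolding e unfolding assms exp_sl2_mat2 x_def[symmetric]
    by (intro has_vector_derivative_mat2 DERIV_add DERIV_diff DERIV_cmult_right dC dS)
qed

subsection \<open>The cotangent bundle of SL(2)\<close>

lemma cof_nonzero: "det x = 1 \<Longrightarrow> 0 < cof x \<bullet> cof x"
  by (cases x rule: mat2_cases) (auto simp del: mat2_arith(6))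

lemma has_vector_derivative_comp_linear:
  assumes "bounded_linear L" "(f has_vector_derivative f') F"
  shows "((\<lambda>t. L (f t)) has_vector_derivative L f') F"
  using bounded_linear.has_vector_derivative[OF assms] by simp

text \<open>Left translation: \<open>adj x\<close> inverts \<open>x\<close>, so
  \<open>v = x ** A\<close> is the initial velocity of \<open>x ** exp_sl2 t A\<close>.\<close>

lemma SL2_curve:
  assumes "x \<in> SL2" and "v \<bullet> cof x = 0"
  obtains \<gamma> where "\<gamma> 0 = x" and "\<And>t. \<gamma> t \<in> SL2"
    and "(\<gamma> has_vector_derivative v) (at 0)"
proof -
  define A where "A = adj x ** v"
  have "det x = 1" using assms by (simp add: SL2_def)
  \<comment> \<open>The trace of \<open>A\<close> equals \<open>v \<bullet> cof x\<close>.\<close>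
  have "A $ 2 $ 2 = - (A $ 1 $ 1)"
    using assms(2) unfolding A_def
    by (cases x rule: mat2_cases, cases v rule: mat2_cases) (simp add: algebra_simps)
  then obtain a b c where A: "A = mat2 a b c (- a)"
    by (metis mat2_eta)
  have v: "x ** A = v"
    by (simp add: A_def matrix_mul_assoc adj_mult \<open>det x = 1\<close>)
  define \<gamma> where "\<gamma> t = x ** exp_sl2 t A" for t
  have d: "(\<gamma> has_vector_derivative x ** (exp_sl2 t A ** A)) (at t)" for t
    unfolding \<gamma>_def[abs_def]
    using has_vector_derivative_matrix_mult[OF has_vector_derivative_const has_vector_derivative_exp_sl2[OF A]]
    by simp
  have "\<gamma> t \<in> SL2" for t
    using \<open>det x = 1\<close> by (simp add: \<gamma>_def SL2_def A det_exp_sl2)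
  moreover have "\<gamma> 0 = x" by (simp add: \<gamma>_def)
  moreover have "(\<gamma> has_vector_derivative v) (at 0)" using d[of 0] by (simp add: v)
  ultimately show ?thesis using that by blast
qed

lemma tangent_space_SL2:
  assumes "x \<in> SL2"
  shows "tangent_space SL2 x = {v. v \<bullet> cof x = 0}"
proof (intro equalityI subsetI)
  fix v assume "v \<in> tangent_space SL2 x"
  then obtain \<gamma> where g: "\<gamma> 0 = x" "\<And>t. \<gamma> t \<in> SL2" "(\<gamma> has_vector_derivative v) (at 0)"
    by (auto simp: tangent_space_def)
  have "((\<lambda>t::real. 1::real) has_real_derivative v \<bullet> cof x) (at 0)"
    using has_real_derivative_det[OF g(3)] g(1,2) by (simp add: SL2_def)
  then show "v \<in> {v. v \<bullet> cof x = 0}" using DERIV_unique[OF _ DERIV_const] by blast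
next
  fix v assume "v \<in> {v. v \<bullet> cof x = 0}"
  with SL2_curve[OF assms, of v] show "v \<in> tangent_space SL2 x"
    unfolding tangent_space_def by auto
qed

lemma cotangent_bundle_SL2: "cotangent_bundle SL2 = {(x, p). det x = 1 \<and> p \<bullet> cof x = 0}"
  using tangent_space_SL2 by (auto simp: cotangent_bundle_def cotangent_space_def SL2_def)

text \<open>Both equations arise by differentiating \<open>det x = 1\<close> and
  \<open>p \<bullet> cof x = 0\<close> along a curve in the bundle.\<close>

lemma tangent_space_bundle_subset:
  assumes "(v, w) \<in> tangent_space (cotangent_bundle SL2) (x, p)"
  shows "v \<bullet> cof x = 0" "w \<bullet> cof x + p \<bullet> cof v = 0"
proof -
  obtain \<gamma> where g: "\<gamma> 0 = (x, p)" "\<And>t. \<gamma> t \<in> cotangent_bundle SL2" "(\<gamma> has_vector_derivative (v, w)) (at 0)"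
    using assms by (auto simp: tangent_space_def)
  have 1: "((\<lambda>t. fst (\<gamma> t)) has_vector_derivative v) (at 0)" and 2: "((\<lambda>t. snd (\<gamma> t)) has_vector_derivative w) (at 0)"
    using has_vector_derivative_comp_linear[OF bounded_linear_fst g(3)]
      has_vector_derivative_comp_linear[OF bounded_linear_snd g(3)] by simp_all
  have d: "det (fst (\<gamma> t)) = 1" "snd (\<gamma> t) \<bullet> cof (fst (\<gamma> t)) = 0" for t
    using g(2)[of t] by (auto simp: cotangent_bundle_SL2 case_prod_beta)
  show "v \<bullet> cof x = 0"
    using has_real_derivative_det[OF 1] DERIV_unique[OF _ DERIV_const] by (force simp: d g)
  show "w \<bullet> cof x + p \<bullet> cof v = 0"
    using has_real_derivative_inner[OF 2 has_vector_derivative_comp_linear[OF bounded_linear_cof 1]]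
      DERIV_unique[OF _ DERIV_const] by (force simp: d g)
qed

text \<open>For the converse, take a curve in SL(2) with velocity \<open>v\<close> and project the
  line \<open>p + t *\<^sub>R w\<close> orthogonally to the cotangent spaces along it. The condition
  on \<open>w\<close> says that the removed component vanishes to first order.\<close>

lemma tangent_space_bundle:
  assumes x: "det x = 1" and p: "p \<bullet> cof x = 0"
  shows "tangent_space (cotangent_bundle SL2) (x, p) = {(v, w). v \<bullet> cof x = 0 \<and> w \<bullet> cof x + p \<bullet> cof v = 0}"
proof (intro equalityI subsetI)
  fix z assume "z \<in> tangent_space (cotangent_bundle SL2) (x, p)"
  then show "z \<in> {(v, w). v \<bullet> cof x = 0 \<and> w \<bullet> cof x + p \<bullet> cof v = 0}"
    using tangent_space_bundle_subset by (cases z) auto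
next
  fix z assume "z \<in> {(v, w). v \<bullet> cof x = 0 \<and> w \<bullet> cof x + p \<bullet> cof v = 0}"
  then obtain v w where z: "z = (v, w)" and v: "v \<bullet> cof x = 0" and w: "w \<bullet> cof x + p \<bullet> cof v = 0" by auto
  obtain \<gamma> where g: "\<gamma> 0 = x" "\<And>t. \<gamma> t \<in> SL2" "(\<gamma> has_vector_derivative v) (at 0)"
    using SL2_curve[of x v] x v by (auto simp: SL2_def)
  have c: "0 < cof (\<gamma> t) \<bullet> cof (\<gamma> t)" for t
    using g(2)[of t] by (intro cof_nonzero) (simp add: SL2_def)
  define r where "r t = ((p + t *\<^sub>R w) \<bullet> cof (\<gamma> t)) / (cof (\<gamma> t) \<bullet> cof (\<gamma> t))" for t
  have dc: "((\<lambda>t. cof (\<gamma> t)) has_vector_derivative cof v) (at 0)"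
    by (rule has_vector_derivative_comp_linear[OF bounded_linear_cof g(3)])
  have dp: "((\<lambda>t. p + t *\<^sub>R w) has_vector_derivative w) (at 0)"
    by (auto intro!: derivative_eq_intros)
  \<comment> \<open>The numerator of \<open>r\<close> and its derivative both vanish at 0, by the
    conditions on \<open>p\<close> and \<open>w\<close>.\<close>
  have "(r has_real_derivative 0) (at 0)"
    unfolding r_def[abs_def]
    by (rule DERIV_cong[OF DERIV_divide[OF has_real_derivative_inner[OF dp dc] has_real_derivative_inner[OF dc dc]]])
      (use c[of 0] w p in \<open>auto simp: g(1)\<close>)
  then have dr: "((\<lambda>t. r t *\<^sub>R cof (\<gamma> t)) has_vector_derivative 0) (at 0)"
    using has_vector_derivative_scaleR[OF _ dc, of r 0] by (simp add: r_def g(1) p)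
  define \<delta> where "\<delta> t = (\<gamma> t, p + t *\<^sub>R w - r t *\<^sub>R cof (\<gamma> t))" for t
  have "\<delta> 0 = (x, p)" by (simp add: \<delta>_def r_def g(1) p)
  moreover have "\<delta> t \<in> cotangent_bundle SL2" for t
    using g(2)[of t] c[of t]
    by (auto simp: \<delta>_def cotangent_bundle_SL2[unfolded SL2_def] SL2_def inner_diff_left r_def)
  moreover have "(\<delta> has_vector_derivative (v, w)) (at 0)"
    unfolding \<delta>_def[abs_def]
    using has_vector_derivative_Pair[OF g(3) has_vector_derivative_diff[OF dp dr]] by simp
  ultimately show "z \<in> tangent_space (cotangent_bundle SL2) (x, p)"
    unfolding z tangent_space_def by blast
qed

subsection \<open>Left-invariant coordinates of covectors\<close>

lemma matrix2_mult_linear: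
  fixes X Y Z :: "real^2^2"
  shows "(X + Y) ** Z = X ** Z + Y ** Z" "X ** (Y + Z) = X ** Y + X ** Z"
    "(X - Y) ** Z = X ** Z - Y ** Z" "X ** (Y - Z) = X ** Y - X ** Z"
    "- X ** Y = - (X ** Y)" "X ** - Y = - (X ** Y)"
    "(r *\<^sub>R X) ** Y = r *\<^sub>R (X ** Y)" "X ** (r *\<^sub>R Y) = r *\<^sub>R (X ** Y)"
  by (cases X rule: mat2_cases, cases Y rule: mat2_cases, cases Z rule: mat2_cases;
      simp add: algebra_simps)+

text \<open>
  With \<open>h\<^sub>i = \<langle>p, X\<^sub>i\<rangle>\<close>, these are \<open>h\<^sub>0/2\<close>, \<open>h\<^sub>1/2\<close>, \<open>h\<^sub>2/2\<close>; the halves turn the matrix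
  \<open>h\<^sub>1 X\<^sub>1 + h\<^sub>2 X\<^sub>2\<close> into \<open>velocity\<close> below.
\<close>

definition mom0 :: "real^2^2 \<Rightarrow> real^2^2 \<Rightarrow> real" where
  "mom0 x p = p \<bullet> (x ** mat2 0 (-1/2) (1/2) 0) / 2"

definition mom1 :: "real^2^2 \<Rightarrow> real^2^2 \<Rightarrow> real" where
  "mom1 x p = p \<bullet> X1 x / 2"

definition mom2 :: "real^2^2 \<Rightarrow> real^2^2 \<Rightarrow> real" where
  "mom2 x p = p \<bullet> X2 x / 2"

lemmas mom_defs = mom0_def mom1_def mom2_def X_mat2

definition velocity :: "real^2^2 \<Rightarrow> real^2^2 \<Rightarrow> real^2^2" where
  "velocity x p = mat2 (mom1 x p) (mom2 x p) (mom2 x p) (- mom1 x p)"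

text \<open>
  The covector at \<open>x\<close> with the coordinates \<open>k\<close>, \<open>a\<close>, \<open>b\<close>. For \<open>det x = 1\<close> the cofactor matrix is the
  inverse transpose, so \<open>cof x ** Y\<close> pairs with \<open>x ** Z\<close> as \<open>Y\<close> with \<open>Z\<close>; it is also the normal
  vector of SL(2) at \<open>x\<close>, and the subtracted term projects to the tangent space.
\<close>

definition momentum :: "real^2^2 \<Rightarrow> real \<Rightarrow> real \<Rightarrow> real \<Rightarrow> real^2^2" where
  "momentum x k a b =
     (let N = cof x ** mat2 (2 * a) (2 * (b - k)) (2 * (b + k)) (- 2 * a)
      in N - (N \<bullet> cof x / (cof x \<bullet> cof x)) *\<^sub>R cof x)"

lemma cof_mult_inner:
  fixes Y Z :: "real^2^2"
  shows "(cof x ** Y) \<bullet> (x ** Z) = det x * (Y \<bullet> Z)"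
  by (cases x rule: mat2_cases, cases Y rule: mat2_cases, cases Z rule: mat2_cases)
    (simp add: algebra_simps)

lemma cof_inner:
  fixes Z :: "real^2^2"
  shows "cof x \<bullet> (x ** Z) = det x * (mat 1 \<bullet> Z)"
  using cof_mult_inner[of x "mat 1" Z] by simp

text \<open>The projection subtracts a multiple of \<open>cof x\<close>, which is orthogonal to
  \<open>x ** Z\<close> for every \<open>Z\<close> of trace zero, so it does not affect the
  coordinates.\<close>

lemma momentum:
  assumes "det x = 1"
  shows "momentum x k a b \<bullet> cof x = 0"
    and "mom0 x (momentum x k a b) = k" and "mom1 x (momentum x k a b) = a" and "mom2 x (momentum x k a b) = b"
  using cof_nonzero[OF assms]
  by (simp_all add: momentum_def Let_def mom_defs inner_diff_left cof_mult_inner cof_inner assms mat2_one field_simps)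

text \<open>Read as a tangent vector, \<open>p\<close> is a combination of the three left-invariant
  fields, so \<open>p \<bullet> p\<close> is a combination of the three coordinates.\<close>

lemma momentum_eq_0:
  assumes "det x = 1" "p \<bullet> cof x = 0" "mom0 x p = 0" "mom1 x p = 0" "mom2 x p = 0"
  shows "p = 0"
proof -
  define A where "A = adj x ** p"
  have "A $ 2 $ 2 = - (A $ 1 $ 1)"
    using assms(2) unfolding A_def
    by (cases x rule: mat2_cases, cases p rule: mat2_cases) (simp add: algebra_simps)
  then obtain l m n where A: "A = mat2 l m n (- l)"
    by (metis mat2_eta)
  have "p \<bullet> p = p \<bullet> (x ** A)"
    by (simp add: A_def matrix_mul_assoc adj_mult \<open>det x = 1\<close>)
  also have "\<dots> = 4 * l * mom1 x p + 2 * (m + n) * mom2 x p + 2 * (n - m) * mom0 x p"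
    unfolding A mom_defs
    by (cases x rule: mat2_cases, cases p rule: mat2_cases) (simp add: field_simps)
  also have "\<dots> = 0" using assms by simp
  finally show ?thesis by simp
qed

lemma mom_diff:
  "mom0 x (p - p') = mom0 x p - mom0 x p'" "mom1 x (p - p') = mom1 x p - mom1 x p'"
  "mom2 x (p - p') = mom2 x p - mom2 x p'"
  by (simp_all add: mom0_def mom1_def mom2_def inner_diff_left diff_divide_distrib)

lemma momentum_eqI:
  assumes "det x = 1" "p \<bullet> cof x = 0" "p' \<bullet> cof x = 0"
    "mom0 x p = mom0 x p'" "mom1 x p = mom1 x p'" "mom2 x p = mom2 x p'"
  shows "p = p'"
  using momentum_eq_0[of x "p - p'"] assms by (simp add: mom_diff inner_diff_left)

lemma velocity_eq: "x ** velocity x p = (2 * mom1 x p) *\<^sub>R X1 x + (2 * mom2 x p) *\<^sub>R X2 x"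
  by (cases x rule: mat2_cases) (simp add: velocity_def X_mat2 algebra_simps)

text \<open>\<open>velocity x p\<close> is symmetric and can be moved across the inner product. The
  result is the base part of the differential of the Hamiltonian.\<close>

lemma velocity_eq': "(p ** velocity x p) \<bullet> v = 2 * mom1 x p * (p \<bullet> X1 v) + 2 * mom2 x p * (p \<bullet> X2 v)"
  by (cases p rule: mat2_cases, cases v rule: mat2_cases) (simp add: velocity_def X_mat2 algebra_simps)

lemma bounded_linear_X: "bounded_linear X1" "bounded_linear X2"
  by (auto simp: X_mat2[abs_def] linear_conv_bounded_linear[symmetric] matrix2_mult_linear intro!: linearI)

subsection \<open>The Hamiltonian flow\<close>

lemma has_derivative_sr_hamiltonian:
  "(sr_hamiltonian has_derivative (\<lambda>\<eta>. snd \<eta> \<bullet> (x ** velocity x p) + (p ** velocity x p) \<bullet> fst \<eta>)) (at (x, p))"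
proof -
  have 1: "sr_hamiltonian = (\<lambda>z. ((snd z \<bullet> X1 (fst z))\<^sup>2 + (snd z \<bullet> X2 (fst z))\<^sup>2) / 2)"
    by (auto simp: sr_hamiltonian_def)
  show ?thesis
    unfolding 1
    by (auto intro!: derivative_eq_intros bounded_linear.has_derivative[OF bounded_linear_X(1)]
        bounded_linear.has_derivative[OF bounded_linear_X(2)]
        simp: velocity_eq velocity_eq' fun_eq_iff inner_add_right mom1_def mom2_def algebra_simps)
qed

text \<open>
  The Hamiltonian field of the ambient space is \<open>(x ** U, - (p ** U))\<close> with \<open>U = velocity x p\<close>. It may be
  changed by a multiple of \<open>(0, cof x)\<close>, which is symplectically orthogonal to the bundle, and
  tangency fixes the multiple.
\<close>

lemma hamiltonian_field_eq:
  assumes x: "det x = 1" and p: "p \<bullet> cof x = 0"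
    and w: "w = - (p ** velocity x p) - s *\<^sub>R cof x"
    and tangent: "w \<bullet> cof x + p \<bullet> cof (x ** velocity x p) = 0"
  shows "hamiltonian_field SL2 sr_hamiltonian (x, p) = (x ** velocity x p, w)"
proof -
  let ?U = "velocity x p"
  let ?T = "tangent_space (cotangent_bundle SL2) (x, p)"
  note T = tangent_space_bundle[OF x p]
  have fd: "frechet_derivative sr_hamiltonian (at (x, p)) = (\<lambda>\<eta>. snd \<eta> \<bullet> (x ** ?U) + (p ** ?U) \<bullet> fst \<eta>)"
    by (rule frechet_derivative_at[OF has_derivative_sr_hamiltonian, symmetric])
  have v: "(x ** ?U) \<bullet> cof x = 0"
    using cof_inner[of x ?U] by (simp add: inner_commute velocity_def mat2_one)
  \<comment> \<open>The term \<open>s *\<^sub>R cof x\<close> in \<open>w\<close> pairs to zero with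
    base components tangent to SL(2).\<close>
  have sol: "symplectic_form \<eta> (x ** ?U, w) = frechet_derivative sr_hamiltonian (at (x, p)) \<eta>" if "\<eta> \<in> ?T" for \<eta>
    using that unfolding T fd
    by (auto simp: symplectic_form_def w inner_diff_left inner_commute[of "cof x"])
  show ?thesis
    unfolding hamiltonian_field_def
  proof (rule the_equality)
    show "(x ** ?U, w) \<in> ?T \<and> (\<forall>\<eta>\<in>?T. symplectic_form \<eta> (x ** ?U, w) = frechet_derivative sr_hamiltonian (at (x, p)) \<eta>)"
      using sol v tangent by (auto simp: T)
  next
    fix \<xi> assume \<xi>: "\<xi> \<in> ?T \<and> (\<forall>\<eta>\<in>?T. symplectic_form \<eta> \<xi> = frechet_derivative sr_hamiltonian (at (x, p)) \<eta>)"
    \<comment> \<open>Uniqueness is nondegeneracy of the symplectic form on the bundle: the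
      difference of two solutions is tested against suitable tangent vectors.\<close>
    define v' w' where "v' = fst \<xi> - x ** ?U" and "w' = snd \<xi> - w"
    have v': "v' \<bullet> cof x = 0" and w': "w' \<bullet> cof x + p \<bullet> cof v' = 0"
      using \<xi> v tangent unfolding T v'_def w'_def
      by (auto simp: inner_diff_left inner_diff_right linear_diff[OF bounded_linear.linear[OF bounded_linear_cof]])
    have om: "snd \<eta> \<bullet> v' = w' \<bullet> fst \<eta>" if "\<eta> \<in> ?T" for \<eta>
    proof -
      have "symplectic_form \<eta> \<xi> = symplectic_form \<eta> (x ** ?U, w)" using sol \<xi> that by simp
      then show ?thesis
        by (simp add: symplectic_form_def v'_def w'_def inner_diff_left inner_diff_right)
    qed
    \<comment> \<open>Testing with this vertical vector gives
      \<open>v' \<bullet> v' = 0\<close>.\<close>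
    have "(0, v') \<in> ?T" using v' by (simp add: T linear_0[OF bounded_linear.linear[OF bounded_linear_cof]])
    then have v0: "v' = 0" using om by fastforce
    \<comment> \<open>Now \<open>w'\<close> is tangent to SL(2), and this \<open>r\<close> makes
      \<open>(w', r *\<^sub>R cof x)\<close> tangent to the bundle. Testing with it gives
      \<open>w' \<bullet> w' = 0\<close>.\<close>
    define r where "r = - (p \<bullet> cof w') / (cof x \<bullet> cof x)"
    have "(w', r *\<^sub>R cof x) \<in> ?T"
      using w' cof_nonzero[OF x] by (simp add: T v0 r_def linear_0[OF bounded_linear.linear[OF bounded_linear_cof]])
    then have "w' = 0" using om v0 by fastforce
    with v0 show "\<xi> = (x ** ?U, w)" by (simp add: v'_def w'_def prod_eq_iff)
  qed
qed

text \<open>Tangency to the bundle is a linear equation for \<open>s\<close> with the nonzero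
  coefficient \<open>cof x \<bullet> cof x\<close>.\<close>

lemma hamiltonian_field_cases:
  assumes x: "det x = 1" and p: "p \<bullet> cof x = 0"
  obtains s where
    "hamiltonian_field SL2 sr_hamiltonian (x, p) = (x ** velocity x p, - (p ** velocity x p) - s *\<^sub>R cof x)"
proof -
  define s where "s = (p \<bullet> cof (x ** velocity x p) - (p ** velocity x p) \<bullet> cof x) / (cof x \<bullet> cof x)"
  show ?thesis
    by (rule that[of s], rule hamiltonian_field_eq[OF x p refl])
      (use cof_nonzero[OF x] in \<open>simp add: s_def inner_diff_left\<close>)
qed

section \<open>Explicit geodesics and their lifts\<close>

definition rot :: "real \<Rightarrow> real^2^2" where
  "rot \<theta> = mat2 (cos \<theta>) (- sin \<theta>) (sin \<theta>) (cos \<theta>)"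

definition geodesic :: "real^2^2 \<Rightarrow> real \<Rightarrow> real \<Rightarrow> real \<Rightarrow> real \<Rightarrow> real^2^2" where
  "geodesic q k a b t = q ** (exp_sl2 t (mat2 a (b + k) (b - k) (- a)) ** rot (k * t))"

text \<open>The solution of the vertical equations: \<open>k\<close> is constant, and
  \<open>(a, b)\<close> rotates with angular velocity \<open>- 2 * k\<close>.\<close>

definition mom1_t :: "real \<Rightarrow> real \<Rightarrow> real \<Rightarrow> real \<Rightarrow> real" where
  "mom1_t k a b t = a * cos (2 * k * t) + b * sin (2 * k * t)"

definition mom2_t :: "real \<Rightarrow> real \<Rightarrow> real \<Rightarrow> real \<Rightarrow> real" where
  "mom2_t k a b t = b * cos (2 * k * t) - a * sin (2 * k * t)"

definition geodesic_vel :: "real \<Rightarrow> real \<Rightarrow> real \<Rightarrow> real \<Rightarrow> real^2^2" where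
  "geodesic_vel k a b t = mat2 (mom1_t k a b t) (mom2_t k a b t) (mom2_t k a b t) (- mom1_t k a b t)"

lemma DERIV_mom_t:
  "(mom1_t k a b has_real_derivative 2 * k * mom2_t k a b t) (at t)"
  "(mom2_t k a b has_real_derivative - 2 * k * mom1_t k a b t) (at t)"
  unfolding mom1_t_def[abs_def] mom2_t_def[abs_def]
  by (auto intro!: derivative_eq_intros simp: algebra_simps)

text \<open>Conjugation by a rotation turns a symmetric matrix of trace zero by twice the
  angle.\<close>

lemma rot_vel: "mat2 a b b (- a) ** rot (k * t) = rot (k * t) ** geodesic_vel k a b t"
proof -
  have 1: "cos (2 * k * t) = (cos (k * t))\<^sup>2 - (sin (k * t))\<^sup>2" "sin (2 * k * t) = 2 * sin (k * t) * cos (k * t)"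
    using cos_double[of "k * t"] sin_double[of "k * t"] by (simp_all add: mult.assoc)
  have 2: "(cos (k * t))\<^sup>2 = 1 - (sin (k * t))\<^sup>2" by (simp add: cos_squared_eq)
  have "rot (k * t) ** geodesic_vel k a b t =
     ((cos (k * t))\<^sup>2 + (sin (k * t))\<^sup>2) *\<^sub>R (mat2 a b b (- a) ** rot (k * t))"
    by (simp only: rot_def geodesic_vel_def mom1_t_def mom2_t_def 1 mat2_arith mat2_eq_iff)
      (intro conjI; algebra)
  then show ?thesis by (simp del: mat2_arith)
qed

lemma has_vector_derivative_rot:
  "((\<lambda>t. rot (k * t)) has_vector_derivative mat2 0 (- k) k 0 ** rot (k * t)) (at t)"
  unfolding rot_def mat2_arith
  by (rule has_vector_derivative_mat2) (auto intro!: derivative_eq_intros)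

lemma det_geodesic: "det q = 1 \<Longrightarrow> det (geodesic q k a b t) = 1"
  by (simp add: geodesic_def det_exp_sl2 del: mat2_arith)
    (simp add: rot_def power2_eq_square[symmetric])

lemma geodesic_0 [simp]: "geodesic q k a b 0 = q"
  by (simp add: geodesic_def rot_def mat2_one[symmetric])

text \<open>The generator of the rotation factor cancels the antisymmetric part of
  \<open>?A\<close>. The symmetric rest is carried past the rotation by
  \<open>rot_vel\<close>.\<close>

lemma has_vector_derivative_geodesic:
  "(geodesic q k a b has_vector_derivative geodesic q k a b t ** geodesic_vel k a b t) (at t)"
proof -
  let ?A = "mat2 a (b + k) (b - k) (- a)"
  have e: "q ** (exp_sl2 t ?A ** ?A ** rot (k * t) + exp_sl2 t ?A ** (mat2 0 (- k) k 0 ** rot (k * t)))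
     = geodesic q k a b t ** geodesic_vel k a b t" (is "?L = _")
  proof -
    have "?L = q ** exp_sl2 t ?A ** ((?A + mat2 0 (- k) k 0) ** rot (k * t))"
      by (simp only: matrix_mul_assoc matrix2_mult_linear)
    also have "?A + mat2 0 (- k) k 0 = mat2 a b b (- a)" by simp
    finally show ?thesis
      by (simp only: rot_vel geodesic_def matrix_mul_assoc)
  qed
  show ?thesis
    using has_vector_derivative_matrix_mult[OF has_vector_derivative_const[of q]
       has_vector_derivative_matrix_mult[OF has_vector_derivative_exp_sl2[OF refl, of a "b + k" "b - k"]
         has_vector_derivative_rot[of k t]]]
    unfolding e[symmetric] unfolding geodesic_def[abs_def] by simp
qed

lemma cof_mult: "cof (x ** y) = cof x ** cof y"
  by (cases x rule: mat2_cases, cases y rule: mat2_cases) (simp add: algebra_simps)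

text \<open>The covector is \<open>cof x ** N\<close> plus a multiple of \<open>cof x\<close>. Both
  \<open>cof x\<close> and \<open>cof x ** N\<close> are multiplied by \<open>- U\<close> from the
  right under differentiation, so \<open>p' = - (p ** U)\<close> up to a multiple of
  \<open>cof x\<close>, as \<open>hamiltonian_field_eq\<close> requires.\<close>

lemma geodesic_lift:
  fixes k a b :: real
  assumes q: "det q = 1"
  defines "x \<equiv> geodesic q k a b"
  defines "p \<equiv> \<lambda>t. momentum (x t) k (mom1_t k a b t) (mom2_t k a b t)"
  shows "((\<lambda>t. (x t, p t)) has_vector_derivative hamiltonian_field SL2 sr_hamiltonian (x t, p t)) (at t)"
proof -
  define U where "U t = geodesic_vel k a b t" for t
  have det: "det (x t) = 1" for t unfolding x_def by (rule det_geodesic[OF q])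
  have vel: "velocity (x t) (p t) = U t" for t
    by (simp add: velocity_def p_def momentum det U_def geodesic_vel_def)
  have dx: "(x has_vector_derivative x t ** U t) (at t)" for t
    unfolding x_def U_def by (rule has_vector_derivative_geodesic)
  have dc: "((\<lambda>t. cof (x t)) has_vector_derivative - (cof (x t) ** U t)) (at t)" for t
  proof -
    have "cof (U t) = - U t" by (simp add: U_def geodesic_vel_def)
    then have "cof (x t ** U t) = - (cof (x t) ** U t)"
      by (simp add: cof_mult matrix2_mult_linear)
    then show ?thesis
      using has_vector_derivative_comp_linear[OF bounded_linear_cof dx, of t] by simp
  qed
  define N where "N t = mat2 (2 * mom1_t k a b t) (2 * (mom2_t k a b t - k)) (2 * (mom2_t k a b t + k)) (- 2 * mom1_t k a b t)" for t
  define N' where "N' t = mat2 (4 * k * mom2_t k a b t) (- 4 * k * mom1_t k a b t) (- 4 * k * mom1_t k a b t) (- 4 * k * mom2_t k a b t)" for t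
  have dN: "(N has_vector_derivative N' t) (at t)" for t
    unfolding N_def[abs_def] N'_def
    by (rule has_vector_derivative_mat2) (auto intro!: derivative_eq_intros DERIV_mom_t)
  \<comment> \<open>The Lax equation: \<open>N'\<close> is the commutator of \<open>U\<close> and
    \<open>N\<close>.\<close>
  have com: "N' t + N t ** U t - U t ** N t = 0" for t
    by (simp add: N_def N'_def U_def geodesic_vel_def algebra_simps)
  define r where "r t = - ((cof (x t) ** N t) \<bullet> cof (x t) / (cof (x t) \<bullet> cof (x t)))" for t
  have p: "p t = cof (x t) ** N t + r t *\<^sub>R cof (x t)" for t
    by (simp add: p_def momentum_def Let_def N_def r_def)
  note dcN = has_vector_derivative_matrix_mult[OF dc dN, of t]
  obtain r' where r': "(r has_real_derivative r') (at t)"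
    unfolding r_def[abs_def]
    using DERIV_minus[OF DERIV_divide[OF has_real_derivative_inner[OF dcN dc] has_real_derivative_inner[OF dc dc]]]
      cof_nonzero[OF det, of t] by auto
  define w where "w = - (cof (x t) ** U t) ** N t + cof (x t) ** N' t + (r t *\<^sub>R - (cof (x t) ** U t) + r' *\<^sub>R cof (x t))"
  have dp: "(p has_vector_derivative w) (at t)"
    unfolding p[abs_def] w_def
    by (intro has_vector_derivative_add dcN has_vector_derivative_scaleR r' dc)
  have "w + p t ** U t - r' *\<^sub>R cof (x t) = cof (x t) ** (N' t + N t ** U t - U t ** N t)"
    unfolding w_def p
    by (simp add: matrix2_mult_linear matrix_mul_assoc)
  then have w: "w = - (p t ** velocity (x t) (p t)) - (- r') *\<^sub>R cof (x t)"
    unfolding com vel by (simp add: algebra_simps)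
  have t: "p t \<bullet> cof (x t) = 0" for t unfolding p_def by (rule momentum(1)[OF det])
  \<comment> \<open>Tangency is the derivative of the identity
    \<open>p t \<bullet> cof (x t) = 0\<close>.\<close>
  have "w \<bullet> cof (x t) + p t \<bullet> cof (x t ** velocity (x t) (p t)) = 0"
    unfolding vel
    using has_real_derivative_inner[OF dp has_vector_derivative_comp_linear[OF bounded_linear_cof dx]]
      DERIV_unique[OF _ DERIV_const] by (force simp: t)
  from hamiltonian_field_eq[OF det t w this] has_vector_derivative_Pair[OF dx dp]
  show ?thesis by (simp add: vel)
qed

text \<open>The quotient \<open>x ** adj y\<close> is constant, because \<open>adj U = - U\<close>
  for \<open>U\<close> of trace zero.\<close>

lemma SL2_ode_unique:
  fixes x y U :: "real \<Rightarrow> real^2^2"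
  assumes x: "\<And>t. (x has_vector_derivative x t ** U t) (at t)"
    and y: "\<And>t. (y has_vector_derivative y t ** U t) (at t)" and "\<And>t. det (y t) = 1"
    and U: "\<And>t. U t $ 2 $ 2 = - (U t $ 1 $ 1)" and "x 0 = y 0"
  shows "x t = y t"
proof -
  have am: "adj (A ** B) = adj B ** adj A" for A B
    by (cases A rule: mat2_cases, cases B rule: mat2_cases) (simp add: algebra_simps)
  have "((\<lambda>t. x t ** adj (y t)) has_vector_derivative 0) (at t)" for t
  proof -
    have "adj (U t) = - U t"
      using U[of t] by (simp add: adj_def) (metis mat2_arith(3) mat2_eta add.inverse_inverse)
    then have "x t ** U t ** adj (y t) + x t ** adj (y t ** U t) = 0"
      by (simp add: am matrix_mul_assoc matrix2_mult_linear)
    then show ?thesis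
      using has_vector_derivative_matrix_mult[OF x has_vector_derivative_comp_linear[OF bounded_linear_adj y], of t]
      by simp
  qed
  from has_vector_derivative_zero_imp_const[OF this, of t] have "x t ** adj (y t) = mat 1"
    using assms by (simp add: adj_mult)
  then have "x t ** adj (y t) ** y t = y t" by simp
  then show ?thesis using assms by (simp add: matrix_mul_assoc[symmetric] adj_mult)
qed

text \<open>The coordinates of any solution satisfy a closed system, free of the unknown multiple of
  \<open>cof x\<close>. Its solution determines the velocity, then \<open>SL2_ode_unique\<close>
  gives the base curve and \<open>momentum_eqI\<close> the covector.\<close>

lemma flow_unique:
  assumes g0: "\<gamma> 0 = (q, p0)"
    and g: "\<And>s. \<gamma> s \<in> cotangent_bundle SL2"
    and dg: "\<And>s. (\<gamma> has_vector_derivative hamiltonian_field SL2 sr_hamiltonian (\<gamma> s)) (at s)"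
  defines "k \<equiv> mom0 q p0" and "a \<equiv> mom1 q p0" and "b \<equiv> mom2 q p0"
  shows "\<gamma> t = (geodesic q k a b t, momentum (geodesic q k a b t) k (mom1_t k a b t) (mom2_t k a b t))"
proof -
  define x p where "x t = fst (\<gamma> t)" and "p t = snd (\<gamma> t)" for t
  have xp: "\<gamma> t = (x t, p t)" for t by (simp add: x_def p_def)
  have det: "det (x t) = 1" and pt: "p t \<bullet> cof (x t) = 0" for t
    using g[of t] by (auto simp: cotangent_bundle_SL2 xp)
  define U where "U t = velocity (x t) (p t)" for t
  have Ut: "U t = mat2 (mom1 (x t) (p t)) (mom2 (x t) (p t)) (mom2 (x t) (p t)) (- mom1 (x t) (p t))" for t
    by (simp add: U_def velocity_def)
  have "\<exists>s. hamiltonian_field SL2 sr_hamiltonian (\<gamma> t) = (x t ** U t, - (p t ** U t) - s *\<^sub>R cof (x t))" for t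
    unfolding xp U_def using hamiltonian_field_cases[OF det pt] by metis
  then obtain s where s: "hamiltonian_field SL2 sr_hamiltonian (\<gamma> t) = (x t ** U t, - (p t ** U t) - s t *\<^sub>R cof (x t))" for t
    by metis
  have dx: "(x has_vector_derivative x t ** U t) (at t)" 
    and dp: "(p has_vector_derivative - (p t ** U t) - s t *\<^sub>R cof (x t)) (at t)" for t
    using has_vector_derivative_comp_linear[OF bounded_linear_fst dg[of t]]
      has_vector_derivative_comp_linear[OF bounded_linear_snd dg[of t]]
    by (simp_all add: s x_def[abs_def, symmetric] p_def[abs_def, symmetric])
  define k' a' b' where "k' t = mom0 (x t) (p t)" and "a' t = mom1 (x t) (p t)" and "b' t = mom2 (x t) (p t)" for t
  have dm: "((\<lambda>t. p t \<bullet> (x t ** M) / 2) has_real_derivative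
      ((- (p t ** U t) - s t *\<^sub>R cof (x t)) \<bullet> (x t ** M) + p t \<bullet> (x t ** U t ** M)) / 2) (at t)" for t M
    using has_vector_derivative_matrix_mult[OF dx has_vector_derivative_const[of M], of t]
    by (intro DERIV_cdivide has_real_derivative_inner dp) simp
  \<comment> \<open>For \<open>M\<close> of trace zero the multiple of \<open>cof X\<close> drops
    out and a commutator remains.\<close>
  have e: "((- (P ** mat2 a b b (-a)) - r *\<^sub>R cof X) \<bullet> (X ** M) + P \<bullet> (X ** mat2 a b b (-a) ** M)) / 2 =
      P \<bullet> (X ** (mat2 a b b (-a) ** M - M ** mat2 a b b (-a))) / 2"
    if "M $ 2 $ 2 = - (M $ 1 $ 1)" for P X M :: "real^2^2" and a b r
    using that
    by (cases P rule: mat2_cases, cases X rule: mat2_cases, cases M rule: mat2_cases)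
      (simp add: algebra_simps)
  have dk: "(k' has_real_derivative 0) (at t)"
    and da: "(a' has_real_derivative 2 * k' t * b' t) (at t)"
    and db: "(b' has_real_derivative - 2 * k' t * a' t) (at t)" for t
    unfolding k'_def[abs_def] a'_def[abs_def] b'_def[abs_def] mom0_def[abs_def] mom1_def[abs_def]
      mom2_def[abs_def] X_mat2
    by (rule DERIV_cong[OF dm];
        simp only: Ut, subst e, simp,
        cases "x t" rule: mat2_cases, cases "p t" rule: mat2_cases, simp add: mom_defs field_simps)+
  have k: "k' t = k" for t
    using has_vector_derivative_zero_imp_const[of k' t] dk
    by (simp add: has_real_derivative_iff_has_vector_derivative k'_def x_def p_def g0 k_def)
  have 0: "a' 0 = a" "b' 0 = b" by (simp_all add: a'_def b'_def x_def p_def g0 a_def b_def)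
  \<comment> \<open>Rotating \<open>(a', b')\<close> back by the angle \<open>2 * k * t\<close>
    gives a constant vector.\<close>
  have "((\<lambda>t. a' t * cos (2 * k * t) - b' t * sin (2 * k * t)) has_real_derivative 0) (at t)"
    "((\<lambda>t. a' t * sin (2 * k * t) + b' t * cos (2 * k * t)) has_real_derivative 0) (at t)" for t
    by (auto intro!: derivative_eq_intros da db simp: k algebra_simps)
  from this[THEN iffD1[OF has_real_derivative_iff_has_vector_derivative], THEN has_vector_derivative_zero_imp_const]
  have ab: "a' t * cos (2 * k * t) - b' t * sin (2 * k * t) = a" "a' t * sin (2 * k * t) + b' t * cos (2 * k * t) = b" for t
    by (simp_all add: 0)
  have inv_rot: "u = c * v + d * w \<and> z = d * v - c * w"
    if "u * v - z * w = c" "u * w + z * v = d" "w\<^sup>2 + v\<^sup>2 = 1" for u v w z c d :: real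
    unfolding that(1,2)[symmetric] using that(3) by (intro conjI; algebra)
  have a': "a' t = mom1_t k a b t" and b': "b' t = mom2_t k a b t" for t
    using inv_rot[OF ab sin_cos_squared_add] by (simp_all add: mom1_t_def mom2_t_def)
  have U: "U t = geodesic_vel k a b t" for t
    by (simp add: Ut geodesic_vel_def a'[symmetric] b'[symmetric]) (simp add: a'_def b'_def)
  have x0: "x 0 = q" by (simp add: x_def g0)
  have x: "x t = geodesic q k a b t" for t
  proof (rule SL2_ode_unique)
    show "(x has_vector_derivative x t ** geodesic_vel k a b t) (at t)" for t using dx[of t] by (simp add: U)
    show "(geodesic q k a b has_vector_derivative geodesic q k a b t ** geodesic_vel k a b t) (at t)" for t
      by (rule has_vector_derivative_geodesic)
    show "det (geodesic q k a b t) = 1" for t using det[of 0] by (simp add: det_geodesic x0)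
  qed (simp_all add: x0 geodesic_vel_def)
  have "p t = momentum (x t) k (mom1_t k a b t) (mom2_t k a b t)"
    by (rule momentum_eqI[OF det pt])
      (use k[of t] a'[of t] b'[of t] in \<open>simp_all add: momentum det k'_def a'_def b'_def\<close>)
  then show ?thesis by (simp add: xp x)
qed

lemma hamiltonian_flow_eq:
  assumes q: "det q = 1" and p: "p \<bullet> cof q = 0"
  defines "k \<equiv> mom0 q p" and "a \<equiv> mom1 q p" and "b \<equiv> mom2 q p"
  shows "hamiltonian_flow SL2 sr_hamiltonian t (q, p) =
    (geodesic q k a b t, momentum (geodesic q k a b t) k (mom1_t k a b t) (mom2_t k a b t))"
proof -
  define \<gamma> where "\<gamma> t = (geodesic q k a b t, momentum (geodesic q k a b t) k (mom1_t k a b t) (mom2_t k a b t))" for t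
  have "momentum q k a b = p"
    by (rule momentum_eqI[OF q]) (simp_all add: momentum q p k_def a_def b_def)
  then have "\<gamma> 0 = (q, p)" by (simp add: \<gamma>_def mom1_t_def mom2_t_def)
  moreover have "\<gamma> s \<in> cotangent_bundle SL2" for s
    by (simp add: \<gamma>_def cotangent_bundle_SL2 momentum det_geodesic q)
  moreover have "(\<gamma> has_vector_derivative hamiltonian_field SL2 sr_hamiltonian (\<gamma> s)) (at s)" for s
    unfolding \<gamma>_def[abs_def] by (rule geodesic_lift[OF q])
  moreover have "\<delta> = \<gamma>" if "\<delta> 0 = (q, p) \<and> (\<forall>s. \<delta> s \<in> cotangent_bundle SL2 \<and>
        (\<delta> has_vector_derivative hamiltonian_field SL2 sr_hamiltonian (\<delta> s)) (at s))" for \<delta>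
    using flow_unique[of \<delta> q p] that by (simp add: fun_eq_iff \<gamma>_def k_def a_def b_def)
  ultimately show ?thesis
    unfolding hamiltonian_flow_def \<gamma>_def[symmetric] by (subst the_equality[of _ \<gamma>]) auto
qed

lemma sr_exp_eq:
  assumes "q \<in> SL2" and "p \<in> cotangent_space SL2 q"
  shows "sr_exp q p = geodesic q (mom0 q p) (mom1 q p) (mom2 q p) 1"
  using assms hamiltonian_flow_eq[of q p 1]
  by (simp add: sr_exp_def cotangent_space_def tangent_space_SL2) (simp add: SL2_def)

subsection \<open>Conjugate covectors\<close>

definition endpoint :: "real \<Rightarrow> real \<Rightarrow> real \<Rightarrow> real^2^2" where
  "endpoint k a b = exp_sl2 1 (mat2 a (b + k) (b - k) (- a)) ** rot k"

text \<open>Real and imaginary part of the component \<open>\<alpha>\<close> of the end point, for \<open>x = a\<^sup>2 + b\<^sup>2 - k\<^sup>2\<close>.\<close>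

definition end1 :: "real \<Rightarrow> real \<Rightarrow> real" where
  "end1 k x = cosh_sqrt x * cos k + k * sinhc_sqrt x * sin k"

definition end2 :: "real \<Rightarrow> real \<Rightarrow> real" where
  "end2 k x = cosh_sqrt x * sin k - k * sinhc_sqrt x * cos k"

text \<open>The split into the complex linear part, with \<alpha> = \<open>end1 + i * end2\<close>,
  and the antilinear part, with \<beta> = \<open>\<beta>1 + i * \<beta>2\<close>. The pair
  \<open>(a, b)\<close> enters \<alpha> only through \<open>x\<close>.\<close>

lemma endpoint_eq:
  fixes k a b :: real
  defines "x \<equiv> a\<^sup>2 + b\<^sup>2 - k\<^sup>2"
  defines "\<beta>1 \<equiv> sinhc_sqrt x * (a * cos k + b * sin k)" and "\<beta>2 \<equiv> sinhc_sqrt x * (b * cos k - a * sin k)"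
  shows "endpoint k a b = mat2 (end1 k x + \<beta>1) (\<beta>2 - end2 k x) (\<beta>2 + end2 k x) (end1 k x - \<beta>1)"
proof -
  have "(a\<^sup>2 + (b + k) * (b - k)) * 1\<^sup>2 = x" by (simp add: x_def power2_eq_square algebra_simps)
  then show ?thesis
    unfolding endpoint_def exp_sl2_mat2 rot_def \<beta>1_def \<beta>2_def end1_def end2_def
    by (simp add: algebra_simps)
qed

lemma sr_exp_endpoint:
  assumes "q \<in> SL2" and "p \<in> cotangent_space SL2 q"
  shows "sr_exp q p = q ** endpoint (mom0 q p) (mom1 q p) (mom2 q p)"
  using sr_exp_eq[OF assms] by (simp add: geodesic_def endpoint_def)

lemma mom_linear:
  "mom0 x (p + t *\<^sub>R v) = mom0 x p + t * mom0 x v" "mom1 x (p + t *\<^sub>R v) = mom1 x p + t * mom1 x v"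
  "mom2 x (p + t *\<^sub>R v) = mom2 x p + t * mom2 x v"
  by (simp_all add: mom0_def mom1_def mom2_def inner_add_left add_divide_distrib)

text \<open>The derivatives of \<alpha> and \<beta> vanish. Outside the three exceptional cases,
  \<alpha> forces \<open>k' = 0\<close>, and then \<beta> forces \<open>a' = b' = 0\<close>.\<close>

lemma endpoint_critical:
  fixes k a b k' a' b' :: real
  defines "x \<equiv> a\<^sup>2 + b\<^sup>2 - k\<^sup>2"
  assumes d: "((\<lambda>t. endpoint (k + t * k') (a + t * a') (b + t * b')) has_vector_derivative 0) (at 0)"
    and nz: "k' \<noteq> 0 \<or> a' \<noteq> 0 \<or> b' \<noteq> 0"
  shows "sinhc_sqrt x = 0 \<or> sinhc_sqrt' x = 0 \<or> (a = 0 \<and> b = 0)"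
proof (rule ccontr)
  assume "\<not> ?thesis"
  then have S: "sinhc_sqrt x \<noteq> 0" and T: "sinhc_sqrt' x \<noteq> 0" and ab: "a\<^sup>2 + b\<^sup>2 \<noteq> 0"
    by (auto simp: sum_power2_eq_zero_iff)
  define kt at' bt xt where "kt t = k + t * k'" and "at' t = a + t * a'" and "bt t = b + t * b'"
    and "xt t = (at' t)\<^sup>2 + (bt t)\<^sup>2 - (kt t)\<^sup>2" for t
  define x' where "x' = 2 * (a * a' + b * b' - k * k')"
  have at0: "kt 0 = k" "at' 0 = a" "bt 0 = b" "xt 0 = x"
    by (simp_all add: kt_def at'_def bt_def xt_def x_def)
  have dk: "(kt has_real_derivative k') (at 0)" and da: "(at' has_real_derivative a') (at 0)"
    and db: "(bt has_real_derivative b') (at 0)"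
    unfolding kt_def[abs_def] at'_def[abs_def] bt_def[abs_def] by (auto intro!: derivative_eq_intros)
  have dx: "(xt has_real_derivative x') (at 0)"
    unfolding xt_def[abs_def] x'_def
    by (auto intro!: derivative_eq_intros dk da db simp: at0)
  have dC: "((\<lambda>t. cosh_sqrt (xt t)) has_real_derivative sinhc_sqrt x / 2 * x') (at 0)"
    using DERIV_chain2[OF DERIV_cosh_sqrt dx] by (simp add: at0)
  have dS: "((\<lambda>t. sinhc_sqrt (xt t)) has_real_derivative sinhc_sqrt' x * x') (at 0)"
    using DERIV_chain2[OF DERIV_sinhc_sqrt dx] by (simp add: at0)
  have dc: "((\<lambda>t. cos (kt t)) has_real_derivative - sin k * k') (at 0)"
    and ds: "((\<lambda>t. sin (kt t)) has_real_derivative cos k * k') (at 0)"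
    using DERIV_chain2[OF DERIV_cos dk] DERIV_chain2[OF DERIV_sin dk] by (simp_all add: at0)
  define f where "f t = endpoint (kt t) (at' t) (bt t)" for t
  have "(f has_vector_derivative mat2 0 0 0 0) (at 0)"
    using d by (simp add: f_def[abs_def] kt_def at'_def bt_def mat2_zero)
  then have f: "((\<lambda>t. f t $ 1 $ 1) has_real_derivative 0) (at 0)" "((\<lambda>t. f t $ 1 $ 2) has_real_derivative 0) (at 0)"
    "((\<lambda>t. f t $ 2 $ 1) has_real_derivative 0) (at 0)" "((\<lambda>t. f t $ 2 $ 2) has_real_derivative 0) (at 0)"
    by (simp_all add: has_vector_derivative_mat2_iff has_real_derivative_iff_has_vector_derivative)
  note fe = f_def endpoint_eq[of "kt t" "at' t" "bt t" for t, folded xt_def]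
  have e: "end1 (kt t) (xt t) = (f t $ 1 $ 1 + f t $ 2 $ 2) / 2" "end2 (kt t) (xt t) = (f t $ 2 $ 1 - f t $ 1 $ 2) / 2"
    "sinhc_sqrt (xt t) * (at' t * cos (kt t) + bt t * sin (kt t)) = (f t $ 1 $ 1 - f t $ 2 $ 2) / 2"
    "sinhc_sqrt (xt t) * (bt t * cos (kt t) - at' t * sin (kt t)) = (f t $ 2 $ 1 + f t $ 1 $ 2) / 2" for t
    by (simp_all add: fe)
  have z: "((\<lambda>t. end1 (kt t) (xt t)) has_real_derivative 0) (at 0)" "((\<lambda>t. end2 (kt t) (xt t)) has_real_derivative 0) (at 0)"
    "((\<lambda>t. sinhc_sqrt (xt t) * (at' t * cos (kt t) + bt t * sin (kt t))) has_real_derivative 0) (at 0)"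
    "((\<lambda>t. sinhc_sqrt (xt t) * (bt t * cos (kt t) - at' t * sin (kt t))) has_real_derivative 0) (at 0)"
    unfolding e by (auto intro!: derivative_eq_intros f)
  define c s S T C where "c = cos k" and "s = sin k" and "S = sinhc_sqrt x" and "T = sinhc_sqrt' x" and "C = cosh_sqrt x"
  note cs = c_def[symmetric] s_def[symmetric] S_def[symmetric] T_def[symmetric] C_def[symmetric]
  have 1: "S / 2 * x' * c - C * (s * k') + ((k' * S + k * (T * x')) * s + k * S * (c * k')) = 0"
    by (rule DERIV_unique[OF _ z(1)], unfold end1_def cs[symmetric])
      (auto intro!: derivative_eq_intros dC dS dc ds dk simp: at0 algebra_simps)
  have 2: "S / 2 * x' * s + C * (c * k') - ((k' * S + k * (T * x')) * c - k * S * (s * k')) = 0"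
    by (rule DERIV_unique[OF _ z(2)], unfold end2_def cs[symmetric])
      (auto intro!: derivative_eq_intros dC dS dc ds dk simp: at0 algebra_simps)
  have 3: "T * x' * (a * c + b * s) + S * (a' * c - a * (s * k') + b' * s + b * (c * k')) = 0"
    by (rule DERIV_unique[OF _ z(3)], unfold cs[symmetric])
      (auto intro!: derivative_eq_intros dC dS dc ds dk da db simp: at0 algebra_simps)
  have 4: "T * x' * (b * c - a * s) + S * (b' * c - b * (s * k') - a' * s - a * (c * k')) = 0"
    by (rule DERIV_unique[OF _ z(4)], unfold cs[symmetric])
      (auto intro!: derivative_eq_intros dC dS dc ds dk da db simp: at0 algebra_simps)
  have p: "s\<^sup>2 + c\<^sup>2 = 1" by (simp add: s_def c_def)
  have TC: "2 * x * T = C - S" unfolding cs[symmetric] by (rule sinhc_sqrt'_mult)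
  have S': "S \<noteq> 0" and T': "T \<noteq> 0" using S T by (simp_all add: cs)
  \<comment> \<open>The real part of the derivative of \<alpha> times \<open>exp (- i * k)\<close>;
    the imaginary part is eliminated likewise below.\<close>
  have "S * (x' / 2 + k * k') = 0" using 1 2 p by algebra
  then have x': "x' = - 2 * k * k'" using S' by simp
  have "k * T * x' + k' * (S - C) = 0" using 1 2 p by algebra
  then have "T * ((a\<^sup>2 + b\<^sup>2) * k') = 0" using TC x' unfolding x_def by algebra
  then have k': "k' = 0" using T' ab by auto
  then have "S * (a' * c + b' * s) = 0" "S * (b' * c - a' * s) = 0" using 3 4 x' by simp_all
  then have 5: "a' * c + b' * s = 0" "b' * c - a' * s = 0" using S' by simp_all
  have "a' = 0" using 5 p by algebra
  moreover have "b' = 0" using 5 p by algebra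
  ultimately show False using nz k' by simp
qed

text \<open>On the line through \<open>p\<close> in a kernel direction, the exponential map has
  velocity zero. The coordinates are linear, so this line is straight in them and
  \<open>endpoint_critical\<close> applies after translation to the identity.\<close>

lemma conjugate_locus_cases:
  assumes q: "q \<in> SL2" and p: "p \<in> conjugate_locus q"
  defines "k \<equiv> mom0 q p" and "a \<equiv> mom1 q p" and "b \<equiv> mom2 q p"
  defines "x \<equiv> a\<^sup>2 + b\<^sup>2 - k\<^sup>2"
  shows "sinhc_sqrt x = 0 \<or> sinhc_sqrt' x = 0 \<or> (a = 0 \<and> b = 0)"
proof -
  let ?M = "cotangent_space SL2 q"
  have M: "?M = {v. v \<bullet> cof q = 0}" by (simp add: cotangent_space_def tangent_space_SL2 q)
  have det: "det q = 1" using q by (simp add: SL2_def)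
  obtain D v where D: "(sr_exp q has_derivative D) (at p within ?M)" and v: "v \<in> ?M" "v \<noteq> 0" "D v = 0"
    and pM: "p \<in> ?M"
    using p by (auto simp: conjugate_locus_def)
  have line: "p + t *\<^sub>R v \<in> ?M" for t using pM v(1) by (simp add: M inner_add_left)
  have "((\<lambda>t. p + t *\<^sub>R v) has_derivative (\<lambda>t. t *\<^sub>R v)) (at 0)"
    by (auto intro!: derivative_eq_intros)
  moreover have "(sr_exp q has_derivative D) (at (p + 0 *\<^sub>R v) within range (\<lambda>t. p + t *\<^sub>R v))"
    using has_derivative_subset[OF D, of "range (\<lambda>t. p + t *\<^sub>R v)"] line by auto
  ultimately have "((\<lambda>t. sr_exp q (p + t *\<^sub>R v)) has_derivative (\<lambda>t. D (t *\<^sub>R v))) (at 0)"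
    using has_derivative_in_compose[of "\<lambda>t. p + t *\<^sub>R v" _ 0 UNIV "sr_exp q" D] by simp
  moreover have "D (t *\<^sub>R v) = 0" for t
    using linear_scale[OF has_derivative_linear[OF D]] v(3) by simp
  ultimately have 1: "((\<lambda>t. sr_exp q (p + t *\<^sub>R v)) has_vector_derivative 0) (at 0)"
    by (simp add: has_vector_derivative_def)
  define e where "e t = endpoint (k + t * mom0 q v) (a + t * mom1 q v) (b + t * mom2 q v)" for t
  have "e = (\<lambda>t. adj q ** sr_exp q (p + t *\<^sub>R v))"
    by (simp add: fun_eq_iff sr_exp_endpoint[OF q line] mom_linear e_def k_def a_def b_def matrix_mul_assoc adj_mult det)
  then have "(e has_vector_derivative 0) (at 0)"
    using has_vector_derivative_matrix_mult[OF has_vector_derivative_const[of "adj q"] 1]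
    by simp
  moreover have "mom0 q v \<noteq> 0 \<or> mom1 q v \<noteq> 0 \<or> mom2 q v \<noteq> 0"
    using momentum_eq_0[OF det, of v] v by (auto simp: M)
  ultimately show ?thesis
    unfolding e_def[abs_def] x_def by (rule endpoint_critical)
qed

text \<open>Reduces continuity of a curve of covectors to that of its coordinates.\<close>

lemma momentum_linear:
  assumes "det q = 1"
  shows "momentum q k a b = k *\<^sub>R momentum q 1 0 0 + a *\<^sub>R momentum q 0 1 0 + b *\<^sub>R momentum q 0 0 1"
proof (rule momentum_eqI[OF assms])
  have 0: "mom0 x (t *\<^sub>R v) = t * mom0 x v" "mom1 x (t *\<^sub>R v) = t * mom1 x v" "mom2 x (t *\<^sub>R v) = t * mom2 x v" for x t v
    by (simp_all add: mom0_def mom1_def mom2_def)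
  note 1 = mom_linear[of _ "_ + _"] mom_linear[of _ "_ *\<^sub>R _"] momentum[OF assms] 0
  show "mom0 q (momentum q k a b) = mom0 q (k *\<^sub>R momentum q 1 0 0 + a *\<^sub>R momentum q 0 1 0 + b *\<^sub>R momentum q 0 0 1)"
    "mom1 q (momentum q k a b) = mom1 q (k *\<^sub>R momentum q 1 0 0 + a *\<^sub>R momentum q 0 1 0 + b *\<^sub>R momentum q 0 0 1)"
    "mom2 q (momentum q k a b) = mom2 q (k *\<^sub>R momentum q 1 0 0 + a *\<^sub>R momentum q 0 1 0 + b *\<^sub>R momentum q 0 0 1)"
    by (simp_all add: 1)
qed (simp_all add: momentum assms inner_add_left)

text \<open>A curve of covectors that is continuous at \<open>t0\<close> stays in \<open>U\<close>
  near \<open>t0\<close>, so two nearby parameters with different coordinates and the same end point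
  refute injectivity.\<close>

lemma not_inj_on_sr_expI:
  fixes k a b :: "real \<Rightarrow> real"
  assumes q: "q \<in> SL2" and U: "openin (top_of_set (cotangent_space SL2 q)) U" and p: "p \<in> U"
    and t0: "k t0 = mom0 q p" "a t0 = mom1 q p" "b t0 = mom2 q p"
    and cont: "isCont k t0" "isCont a t0" "isCont b t0"
    and coincide: "\<And>d. d > 0 \<Longrightarrow> \<exists>s t. \<bar>s - t0\<bar> < d \<and> \<bar>t - t0\<bar> < d \<and> (k s, a s, b s) \<noteq> (k t, a t, b t) \<and>
        endpoint (k s) (a s) (b s) = endpoint (k t) (a t) (b t)"
  shows "\<not> inj_on (sr_exp q) U"
proof -
  let ?M = "cotangent_space SL2 q"
  have M: "?M = {v. v \<bullet> cof q = 0}" by (simp add: cotangent_space_def tangent_space_SL2 q)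
  have det: "det q = 1" using q by (simp add: SL2_def)
  obtain W where W: "open W" "U = ?M \<inter> W" using U by (auto simp: openin_open)
  define m where "m t = momentum q (k t) (a t) (b t)" for t
  have mM: "m t \<in> ?M" for t by (simp add: M m_def momentum det)
  have "m t0 = p"
    unfolding m_def t0 by (rule momentum_eqI[OF det]) (use p W in \<open>auto simp: momentum det M\<close>)
  then have mt0: "m t0 \<in> W" using p W by simp
  have m: "m t = k t *\<^sub>R momentum q 1 0 0 + a t *\<^sub>R momentum q 0 1 0 + b t *\<^sub>R momentum q 0 0 1" for t
    unfolding m_def by (rule momentum_linear[OF det])
  have "isCont m t0"
    unfolding ext[of m, OF m] by (intro continuous_intros cont)
  then have "(m \<longlongrightarrow> m t0) (nhds t0)"
    by (simp add: isCont_def tendsto_at_iff_tendsto_nhds)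
  then have "\<forall>\<^sub>F t in nhds t0. m t \<in> W"
    using W(1) mt0 topological_tendstoD by blast
  then obtain d where d: "d > 0" "\<And>t. \<bar>t - t0\<bar> < d \<Longrightarrow> m t \<in> W"
    by (auto simp: eventually_nhds_metric dist_real_def)
  obtain s t where st: "\<bar>s - t0\<bar> < d" "\<bar>t - t0\<bar> < d" "(k s, a s, b s) \<noteq> (k t, a t, b t)"
    "endpoint (k s) (a s) (b s) = endpoint (k t) (a t) (b t)"
    using coincide[OF d(1)] by blast
  have "m s \<in> U" "m t \<in> U" using st d mM W by auto
  moreover have "sr_exp q (m s) = sr_exp q (m t)"
    unfolding sr_exp_endpoint[OF q mM] using st(4) by (simp add: m_def momentum det)
  moreover have "m s \<noteq> m t"
  proof
    assume "m s = m t"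
    then have "mom0 q (m s) = mom0 q (m t)" "mom1 q (m s) = mom1 q (m t)" "mom2 q (m s) = mom2 q (m t)"
      by simp_all
    then show False using st(3) by (simp add: m_def momentum det)
  qed
  ultimately show ?thesis by (auto simp: inj_on_def)
qed

lemma rotate_norm:
  fixes a b :: real
  shows "(a * cos \<theta> - b * sin \<theta>)\<^sup>2 + (a * sin \<theta> + b * cos \<theta>)\<^sup>2 = a\<^sup>2 + b\<^sup>2"
proof -
  have "(a * c - b * s)\<^sup>2 + (a * s + b * c)\<^sup>2 = (a\<^sup>2 + b\<^sup>2) * (s\<^sup>2 + c\<^sup>2)" for s c
    by algebra
  from this[of "cos \<theta>" "sin \<theta>"] show ?thesis by simp
qed

subsection \<open>The fold\<close>

text \<open>
  On the level set of \<open>\<bar>\<beta>\<bar> = \<bar>B\<bar>\<close> parametrised by \<open>\<tau> = sqrt (- x)\<close>, \<open>turn\<close> is \<open>k * sinhc_sqrt x\<close> and \<open>angle\<close>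
  is, up to a constant, the argument of \<open>\<alpha>\<close>; here \<open>\<kappa> = \<plusminus>1\<close> is the sign of \<open>turn\<close>.
\<close>

definition turn :: "real \<Rightarrow> real \<Rightarrow> real \<Rightarrow> real" where
  "turn \<kappa> B \<tau> = \<kappa> * sqrt ((sin \<tau>)\<^sup>2 + B\<^sup>2)"

definition angle :: "real \<Rightarrow> real \<Rightarrow> real \<Rightarrow> real" where
  "angle \<kappa> B \<tau> = \<tau> * turn \<kappa> B \<tau> / sin \<tau> + arctan (cos \<tau> / turn \<kappa> B \<tau>)"

lemma turn:
  assumes "\<kappa>\<^sup>2 = 1" and "B \<noteq> 0"
  shows "(turn \<kappa> B \<tau>)\<^sup>2 = (sin \<tau>)\<^sup>2 + B\<^sup>2" "turn \<kappa> B \<tau> \<noteq> 0" "0 < \<kappa> * turn \<kappa> B \<tau>"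
proof -
  have "0 < (sin \<tau>)\<^sup>2 + B\<^sup>2" using assms by (simp add: add_nonneg_pos)
  then show "(turn \<kappa> B \<tau>)\<^sup>2 = (sin \<tau>)\<^sup>2 + B\<^sup>2" "0 < \<kappa> * turn \<kappa> B \<tau>"
    using assms by (simp_all add: turn_def power_mult_distrib mult.assoc[symmetric] power2_eq_square[symmetric])
  then show "turn \<kappa> B \<tau> \<noteq> 0" by auto
qed

lemma DERIV_turn:
  assumes "\<kappa>\<^sup>2 = 1" and "B \<noteq> 0"
  shows "(turn \<kappa> B has_real_derivative sin \<tau> * cos \<tau> / turn \<kappa> B \<tau>) (at \<tau>)"
proof -
  have 0: "0 < (sin \<tau>)\<^sup>2 + B\<^sup>2" using assms by (simp add: add_nonneg_pos)
  have "(turn \<kappa> B has_real_derivative \<kappa> * (2 * sin \<tau> * cos \<tau> * (inverse (sqrt ((sin \<tau>)\<^sup>2 + B\<^sup>2)) / 2))) (at \<tau>)"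
    unfolding turn_def[abs_def] using 0
    by (auto intro!: derivative_eq_intros)
  \<comment> \<open>\<kappa> is its own inverse, so it can move into the denominator.\<close>
  moreover have "\<kappa> * (2 * sin \<tau> * cos \<tau> * (inverse (sqrt ((sin \<tau>)\<^sup>2 + B\<^sup>2)) / 2)) = sin \<tau> * cos \<tau> / turn \<kappa> B \<tau>"
    using assms(1) unfolding turn_def by (auto simp: power2_eq_1_iff field_simps)
  ultimately show ?thesis by simp
qed

text \<open>The arctangent contributes \<open>- s / u\<close>. With it the numerator factors as
  \<open>(u\<^sup>2 - s\<^sup>2) * (s - \<tau> * c)\<close>, and
  \<open>u\<^sup>2 - s\<^sup>2 = B\<^sup>2\<close>.\<close>

lemma DERIV_angle:
  assumes "\<kappa>\<^sup>2 = 1" and "B \<noteq> 0" and "sin \<tau> \<noteq> 0"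
  shows "(angle \<kappa> B has_real_derivative B\<^sup>2 * (sin \<tau> - \<tau> * cos \<tau>) / (turn \<kappa> B \<tau> * (sin \<tau>)\<^sup>2)) (at \<tau>)"
proof -
  define u where "u = turn \<kappa> B \<tau>"
  define s c where "s = sin \<tau>" and "c = cos \<tau>"
  have u: "u \<noteq> 0" "u\<^sup>2 = s\<^sup>2 + B\<^sup>2" unfolding u_def s_def using turn[OF assms(1,2)] by simp_all
  have s: "s \<noteq> 0" "s\<^sup>2 + c\<^sup>2 = 1" using assms by (simp_all add: s_def c_def)
  have uc: "u\<^sup>2 + c\<^sup>2 = 1 + B\<^sup>2" "1 + B\<^sup>2 \<noteq> 0"
    using u s sum_power2_eq_zero_iff[of 1 B] by auto
  have d: "(angle \<kappa> B has_real_derivative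
      ((u + \<tau> * (s * c / u)) * s - \<tau> * u * c) / (s * s) + inverse (1 + (c / u)\<^sup>2) * ((- s * u - c * (s * c / u)) / (u * u))) (at \<tau>)"
    using DERIV_add[OF DERIV_divide[OF DERIV_mult[OF DERIV_ident DERIV_turn[OF assms(1,2)]] DERIV_sin assms(3)]
        DERIV_chain2[OF DERIV_arctan DERIV_divide[OF DERIV_cos DERIV_turn[OF assms(1,2)] turn(2)[OF assms(1,2)]]]]
    unfolding angle_def[abs_def] u_def s_def c_def
    by (rule DERIV_cong) (simp add: algebra_simps)
  have "inverse (1 + (c / u)\<^sup>2) * ((- s * u - c * (s * c / u)) / (u * u)) = - s / u"
  proof -
    have "inverse (1 + (c / u)\<^sup>2) = u\<^sup>2 / (1 + B\<^sup>2)" using u(1) uc by (simp add: field_simps)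
    moreover have "- s * u - c * (s * c / u) = - (s * (1 + B\<^sup>2)) / u"
      using u(1) uc(1)[symmetric] by (simp add: field_simps power2_eq_square)
    moreover have "u\<^sup>2 / D * (- (s * D) / u / (u * u)) = - s / u" if "D \<noteq> 0" for D
      using u(1) that by (simp add: field_simps power2_eq_square)
    ultimately show ?thesis using uc(2) by (simp only:)
  qed
  moreover have "((u + \<tau> * (s * c / u)) * s - \<tau> * u * c) / (s * s) - s / u = (u\<^sup>2 - s\<^sup>2) * (s - \<tau> * c) / (u * s\<^sup>2)"
    using u(1) s(1) by (simp add: field_simps power2_eq_square)
  ultimately show ?thesis
    using d u(2) unfolding u_def[symmetric] s_def[symmetric] c_def[symmetric]
    by (simp del: minus_divide_left)
qed

text \<open>A continuous injective function on an interval is strictly monotone, but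
  \<open>angle\<close> has a strict local extremum at \<open>\<tau>\<^sub>0\<close>.\<close>

lemma angle_not_inj:
  assumes crit: "sin \<tau>\<^sub>0 = \<tau>\<^sub>0 * cos \<tau>\<^sub>0" and \<kappa>: "\<kappa>\<^sup>2 = 1" and B: "B \<noteq> 0" and d: "0 < d"
    and pos: "\<And>\<tau>. \<bar>\<tau> - \<tau>\<^sub>0\<bar> < d \<Longrightarrow> 0 < \<tau> \<and> 0 < \<sigma> * sin \<tau>"
  shows "\<exists>s t. \<bar>s - \<tau>\<^sub>0\<bar> < d \<and> \<bar>t - \<tau>\<^sub>0\<bar> < d \<and> s \<noteq> t \<and> angle \<kappa> B s = angle \<kappa> B t"
proof (rule ccontr)
  assume neg: "\<not> ?thesis"
  \<comment> \<open>Apart from the sign \<sigma>, the factor of the derivative that changes sign; it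
    is increasing because its derivative is \<open>\<tau> * (\<sigma> * sin \<tau>)\<close>.\<close>
  define f where "f \<tau> = \<sigma> * (sin \<tau> - \<tau> * cos \<tau>)" for \<tau>
  have df: "(f has_real_derivative \<tau> * (\<sigma> * sin \<tau>)) (at \<tau>)" for \<tau>
    unfolding f_def[abs_def] by (auto intro!: derivative_eq_intros simp: algebra_simps)
  have f0: "f \<tau>\<^sub>0 = 0" by (simp add: f_def crit)
  have f_mono: "f s < f t" if "s < t" "\<bar>s - \<tau>\<^sub>0\<bar> < d" "\<bar>t - \<tau>\<^sub>0\<bar> < d" for s t
  proof (rule DERIV_pos_imp_increasing[OF that(1)])
    fix \<tau> assume "s \<le> \<tau>" "\<tau> \<le> t"
    then have "\<bar>\<tau> - \<tau>\<^sub>0\<bar> < d" using that by linarith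
    then show "\<exists>y. DERIV f \<tau> :> y \<and> 0 < y" using df pos by (intro exI conjI mult_pos_pos) auto
  qed
  \<comment> \<open>The signs make the derivative of \<open>g\<close> a positive multiple of
    \<open>f\<close>, so the extremum is a minimum.\<close>
  define g where "g \<tau> = \<sigma> * \<kappa> * angle \<kappa> B \<tau>" for \<tau>
  define r where "r \<tau> = B\<^sup>2 / (\<kappa> * turn \<kappa> B \<tau> * (sin \<tau>)\<^sup>2)" for \<tau>
  have r: "0 < r \<tau>" if "\<bar>\<tau> - \<tau>\<^sub>0\<bar> < d" for \<tau>
    using that pos[of \<tau>] turn(3)[OF \<kappa> B, of \<tau>] B unfolding r_def
    by (intro divide_pos_pos mult_pos_pos[of "\<kappa> * _"]) auto
  have dg: "(g has_real_derivative r \<tau> * f \<tau>) (at \<tau>)" if "\<bar>\<tau> - \<tau>\<^sub>0\<bar> < d" for \<tau>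
  proof -
    have "sin \<tau> \<noteq> 0" using pos[OF that] by auto
    have "r \<tau> = \<kappa> * (B\<^sup>2 / (turn \<kappa> B \<tau> * (sin \<tau>)\<^sup>2))"
      using \<kappa> by (auto simp: r_def power2_eq_1_iff)
    then have e: "\<sigma> * \<kappa> * (B\<^sup>2 * (sin \<tau> - \<tau> * cos \<tau>) / (turn \<kappa> B \<tau> * (sin \<tau>)\<^sup>2)) = r \<tau> * f \<tau>"
      by (simp add: f_def)
    show ?thesis
      unfolding g_def[abs_def] e[symmetric]
      by (rule DERIV_cmult[OF DERIV_angle[OF \<kappa> B \<open>sin \<tau> \<noteq> 0\<close>]])
  qed
  define lo hi where "lo = \<tau>\<^sub>0 - d / 2" and "hi = \<tau>\<^sub>0 + d / 2"
  have near: "\<bar>\<tau> - \<tau>\<^sub>0\<bar> < d" if "\<tau> \<in> {lo..hi}" for \<tau> using that d by (auto simp: lo_def hi_def)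
  have lt: "lo < \<tau>\<^sub>0" "\<tau>\<^sub>0 < hi" using d by (auto simp: lo_def hi_def)
  have cont: "continuous_on {lo..hi} g"
    using dg near by (intro continuous_at_imp_continuous_on ballI) (blast intro: DERIV_isCont)
  have "inj_on g {lo..hi}"
  proof (rule inj_onI)
    fix s t assume st: "s \<in> {lo..hi}" "t \<in> {lo..hi}" "g s = g t"
    have "\<sigma> * \<kappa> \<noteq> 0" using pos[of \<tau>\<^sub>0] \<kappa> d by auto
    then show "s = t" using st neg near by (auto simp: g_def)
  qed
  from continuous_inj_imp_mono[OF lt cont this]
  have "(g lo < g \<tau>\<^sub>0 \<and> g \<tau>\<^sub>0 < g hi) \<or> (g hi < g \<tau>\<^sub>0 \<and> g \<tau>\<^sub>0 < g lo)" .
  moreover have "g \<tau>\<^sub>0 < g hi"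
  proof (rule DERIV_pos_imp_increasing_open[OF lt(2)])
    fix \<tau> assume t: "\<tau>\<^sub>0 < \<tau>" "\<tau> < hi"
    then have n: "\<bar>\<tau> - \<tau>\<^sub>0\<bar> < d" using lt by (intro near) auto
    then have "0 < f \<tau>" using f_mono[of \<tau>\<^sub>0 \<tau>] t d f0 by simp
    then show "\<exists>y. DERIV g \<tau> :> y \<and> 0 < y" by (intro exI[of _ "r \<tau> * f \<tau>"] conjI dg n mult_pos_pos r)
  qed (use lt in \<open>auto intro: continuous_on_subset[OF cont]\<close>)
  moreover have "g \<tau>\<^sub>0 < g lo"
  proof (rule DERIV_neg_imp_decreasing_open[OF lt(1)])
    fix \<tau> assume t: "lo < \<tau>" "\<tau> < \<tau>\<^sub>0"
    then have n: "\<bar>\<tau> - \<tau>\<^sub>0\<bar> < d" using lt by (intro near) auto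
    then have "f \<tau> < 0" using f_mono[of \<tau> \<tau>\<^sub>0] t d f0 by simp
    then show "\<exists>y. DERIV g \<tau> :> y \<and> y < 0" by (intro exI[of _ "r \<tau> * f \<tau>"] conjI dg n mult_pos_neg r)
  qed (use lt in \<open>auto intro: continuous_on_subset[OF cont]\<close>)
  ultimately show False by linarith
qed

text \<open>On the curve, \<open>C - i * k * S\<close> is \<open>cos \<tau> - i * u\<close>, of
  modulus \<open>sqrt (1 + B\<^sup>2)\<close>. Thus \<alpha> is
  \<open>- i * \<kappa> * sqrt (1 + B\<^sup>2) * exp (i * angle)\<close>.\<close>

lemma end_angle:
  assumes "\<kappa>\<^sup>2 = 1" and "B \<noteq> 0" and "sin \<tau> \<noteq> 0" and "\<tau> \<noteq> 0"
  defines "k \<equiv> \<tau> * turn \<kappa> B \<tau> / sin \<tau>"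
  shows "end1 k (- \<tau>\<^sup>2) = \<kappa> * sqrt (1 + B\<^sup>2) * sin (angle \<kappa> B \<tau>)"
    and "end2 k (- \<tau>\<^sup>2) = - \<kappa> * sqrt (1 + B\<^sup>2) * cos (angle \<kappa> B \<tau>)"
proof -
  define u where "u = turn \<kappa> B \<tau>"
  define y where "y = arctan (cos \<tau> / u)"
  have u: "u \<noteq> 0" "u\<^sup>2 = (sin \<tau>)\<^sup>2 + B\<^sup>2" "0 < \<kappa> * u"
    unfolding u_def using turn[OF assms(1,2)] by simp_all
  have "\<kappa> = 1 \<or> \<kappa> = -1" using assms(1) by (simp add: power2_eq_1_iff)
  then have \<kappa>u: "\<kappa> * \<bar>u\<bar> = u" using u(3) by auto
  have "1 + (cos \<tau> / u)\<^sup>2 = (1 + B\<^sup>2) / u\<^sup>2"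
  proof -
    have "u\<^sup>2 + (cos \<tau>)\<^sup>2 = 1 + B\<^sup>2" using u(2) sin_cos_squared_add[of \<tau>] by simp
    moreover have "1 + (cos \<tau> / u)\<^sup>2 = (u\<^sup>2 + (cos \<tau>)\<^sup>2) / u\<^sup>2" using u(1) by (simp add: field_simps)
    ultimately show ?thesis by simp
  qed
  then have "sqrt (1 + (cos \<tau> / u)\<^sup>2) = sqrt (1 + B\<^sup>2) / \<bar>u\<bar>"
    by (simp add: real_sqrt_divide)
  moreover have "sqrt (1 + B\<^sup>2) \<noteq> 0" using sum_power2_eq_zero_iff[of 1 B] by auto
  ultimately have "sqrt (1 + B\<^sup>2) * cos y = \<bar>u\<bar>"
    unfolding y_def cos_arctan by simp
  then have cy: "\<kappa> * sqrt (1 + B\<^sup>2) * cos y = u"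
    using \<kappa>u by (simp add: mult.assoc)
  have sy: "\<kappa> * sqrt (1 + B\<^sup>2) * sin y = cos \<tau>"
  proof -
    have "sin y = cos y * (cos \<tau> / u)"
      using tan_arctan[of "cos \<tau> / u"] cos_arctan_not_zero[of "cos \<tau> / u"]
      unfolding y_def tan_def by (simp add: field_simps)
    then show ?thesis using cy u(1) by (simp add: mult.assoc[symmetric])
  qed
  have kS: "k * sinhc_sqrt (- \<tau>\<^sup>2) = u"
    using sinhc_sqrt_minus_square[of \<tau>] assms(3,4) by (simp add: k_def u_def field_simps)
  have an: "angle \<kappa> B \<tau> = k + y" by (simp add: angle_def k_def y_def u_def)
  show "end1 k (- \<tau>\<^sup>2) = \<kappa> * sqrt (1 + B\<^sup>2) * sin (angle \<kappa> B \<tau>)"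
    "end2 k (- \<tau>\<^sup>2) = - \<kappa> * sqrt (1 + B\<^sup>2) * cos (angle \<kappa> B \<tau>)"
    unfolding end1_def end2_def an sin_add cos_add cosh_sqrt_minus_square kS
    unfolding cy[symmetric] sy[symmetric] by (simp_all add: algebra_simps)
qed

lemma fold_curve:
  fixes k\<^sub>0 a\<^sub>0 b\<^sub>0 :: real
  defines "x \<equiv> a\<^sub>0\<^sup>2 + b\<^sub>0\<^sup>2 - k\<^sub>0\<^sup>2"
  assumes ab: "a\<^sub>0 \<noteq> 0 \<or> b\<^sub>0 \<noteq> 0" and S: "sinhc_sqrt x \<noteq> 0" and T: "sinhc_sqrt' x = 0"
  obtains k a b :: "real \<Rightarrow> real" and t0 where "k t0 = k\<^sub>0" "a t0 = a\<^sub>0" "b t0 = b\<^sub>0"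
    "isCont k t0" "isCont a t0" "isCont b t0"
    "\<And>d. d > 0 \<Longrightarrow> \<exists>s t. \<bar>s - t0\<bar> < d \<and> \<bar>t - t0\<bar> < d \<and> (k s, a s, b s) \<noteq> (k t, a t, b t) \<and>
        endpoint (k s) (a s) (b s) = endpoint (k t) (a t) (b t)"
proof -
  define t0 where "t0 = sqrt (- x)"
  define \<rho> where "\<rho> = sqrt (a\<^sub>0\<^sup>2 + b\<^sub>0\<^sup>2)"
  have "x < 0" using sinhc_sqrt'_pos[of x] T by fastforce
  then have t0: "0 < t0" "t0\<^sup>2 = - x" by (simp_all add: t0_def)
  have x: "x = - t0\<^sup>2" using t0 by simp
  have \<rho>: "0 < \<rho>" "\<rho>\<^sup>2 = a\<^sub>0\<^sup>2 + b\<^sub>0\<^sup>2"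
    using ab by (simp_all add: \<rho>_def sum_power2_gt_zero_iff)
  have k0: "k\<^sub>0\<^sup>2 = t0\<^sup>2 + \<rho>\<^sup>2" using t0 \<rho> by (simp add: x_def)
  have k0_nz: "k\<^sub>0 \<noteq> 0" using k0 \<rho>(1) t0(1) add_pos_pos[of "t0\<^sup>2" "\<rho>\<^sup>2"] by auto
  have st: "sin t0 = t0 * sinhc_sqrt x" and ct: "cos t0 = cosh_sqrt x"
    unfolding x by (simp_all add: sinhc_sqrt_minus_square cosh_sqrt_minus_square)
  have crit: "sin t0 = t0 * cos t0" using st ct sinhc_sqrt'_mult[of x] T by simp
  have sin_nz: "sin t0 \<noteq> 0" using st S t0 by simp
  \<comment> \<open>This is \<rho> times \<open>sinhc_sqrt x\<close>, so its absolute value is the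
    modulus of \<beta> at the given covector.\<close>
  define B where "B = \<rho> * sin t0 / t0"
  have B: "B \<noteq> 0" using \<rho> sin_nz t0 by (simp add: B_def)
  define \<kappa> where "\<kappa> = sgn (k\<^sub>0 * sin t0)"
  have \<kappa>: "\<kappa>\<^sup>2 = 1" using k0_nz sin_nz by (auto simp: \<kappa>_def sgn_if)
  have turn0: "turn \<kappa> B t0 = k\<^sub>0 * sin t0 / t0"
  proof -
    have "(sin t0)\<^sup>2 + B\<^sup>2 = (k\<^sub>0 * sin t0 / t0)\<^sup>2"
      using t0(1) unfolding B_def power_mult_distrib power_divide k0 by (simp add: field_simps)
    then have "turn \<kappa> B t0 = \<kappa> * (\<bar>k\<^sub>0 * sin t0\<bar> / t0)" using t0(1) by (simp add: turn_def abs_mult)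
    then show ?thesis by (simp add: \<kappa>_def sgn_mult_abs)
  qed
  define k where "k \<tau> = \<tau> * turn \<kappa> B \<tau> / sin \<tau>" for \<tau>
  \<comment> \<open>The scale for which \<open>sinhc_sqrt (- \<tau>\<^sup>2)\<close> times the
    length of \<open>(a, b)\<close> stays constant. The rotation by
    \<open>k \<tau> - k\<^sub>0\<close> in \<open>a\<close> and \<open>b\<close> keeps the argument
    of \<beta> constant.\<close>
  define l where "l \<tau> = B * \<tau> / (\<rho> * sin \<tau>)" for \<tau>
  define a where "a \<tau> = l \<tau> * (a\<^sub>0 * cos (k \<tau> - k\<^sub>0) - b\<^sub>0 * sin (k \<tau> - k\<^sub>0))" for \<tau>
  define b where "b \<tau> = l \<tau> * (a\<^sub>0 * sin (k \<tau> - k\<^sub>0) + b\<^sub>0 * cos (k \<tau> - k\<^sub>0))" for \<tau>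
  have init: "k t0 = k\<^sub>0" "l t0 = 1" using t0 sin_nz \<rho>
    by (simp add: k_def turn0, simp add: l_def B_def)
  then have init': "a t0 = a\<^sub>0" "b t0 = b\<^sub>0" by (simp_all add: a_def b_def)
  have cu: "isCont (turn \<kappa> B) t0" by (rule DERIV_isCont[OF DERIV_turn[OF \<kappa> B]])
  have ck: "isCont k t0" and cl: "isCont l t0"
    unfolding k_def[abs_def] l_def[abs_def] using cu sin_nz \<rho> by (auto intro!: continuous_intros)
  have cab: "isCont a t0" "isCont b t0"
    unfolding a_def[abs_def] b_def[abs_def] using ck cl by (auto intro!: continuous_intros)
  have ab2: "(a \<tau>)\<^sup>2 + (b \<tau>)\<^sup>2 - (k \<tau>)\<^sup>2 = - \<tau>\<^sup>2" if "sin \<tau> \<noteq> 0" for \<tau>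
  proof -
    have "(a \<tau>)\<^sup>2 + (b \<tau>)\<^sup>2 = (l \<tau>)\<^sup>2 * (a\<^sub>0\<^sup>2 + b\<^sub>0\<^sup>2)"
      unfolding a_def b_def power_mult_distrib distrib_left[symmetric] rotate_norm ..
    also have "\<dots> = B\<^sup>2 * \<tau>\<^sup>2 / (sin \<tau>)\<^sup>2"
      unfolding \<rho>(2)[symmetric] l_def using \<rho>(1) by (simp add: power_mult_distrib power_divide)
    finally have "(a \<tau>)\<^sup>2 + (b \<tau>)\<^sup>2 = B\<^sup>2 * \<tau>\<^sup>2 / (sin \<tau>)\<^sup>2" .
    moreover have "(k \<tau>)\<^sup>2 = \<tau>\<^sup>2 * ((sin \<tau>)\<^sup>2 + B\<^sup>2) / (sin \<tau>)\<^sup>2"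
      by (simp add: k_def power_mult_distrib power_divide turn(1)[OF \<kappa> B])
    moreover have "\<dots> = \<tau>\<^sup>2 + B\<^sup>2 * \<tau>\<^sup>2 / (sin \<tau>)\<^sup>2"
      using that by (simp add: field_simps)
    ultimately show ?thesis by simp
  qed
  have side: "sinhc_sqrt (- \<tau>\<^sup>2) * (a \<tau> * cos (k \<tau>) + b \<tau> * sin (k \<tau>)) = B / \<rho> * (a\<^sub>0 * cos k\<^sub>0 + b\<^sub>0 * sin k\<^sub>0)"
      "sinhc_sqrt (- \<tau>\<^sup>2) * (b \<tau> * cos (k \<tau>) - a \<tau> * sin (k \<tau>)) = B / \<rho> * (b\<^sub>0 * cos k\<^sub>0 - a\<^sub>0 * sin k\<^sub>0)"
    if "sin \<tau> \<noteq> 0" "\<tau> \<noteq> 0" for \<tau>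
  proof -
    have lS: "sinhc_sqrt (- \<tau>\<^sup>2) * l \<tau> = B / \<rho>"
      using sinhc_sqrt_minus_square[of \<tau>] that \<rho>(1) by (simp add: l_def field_simps)
    have r: "cos k\<^sub>0 = cos (k \<tau>) * cos (k \<tau> - k\<^sub>0) + sin (k \<tau>) * sin (k \<tau> - k\<^sub>0)"
      "sin k\<^sub>0 = sin (k \<tau>) * cos (k \<tau> - k\<^sub>0) - cos (k \<tau>) * sin (k \<tau> - k\<^sub>0)"
      using cos_diff[of "k \<tau>" "k \<tau> - k\<^sub>0"] sin_diff[of "k \<tau>" "k \<tau> - k\<^sub>0"] by simp_all
    show "sinhc_sqrt (- \<tau>\<^sup>2) * (a \<tau> * cos (k \<tau>) + b \<tau> * sin (k \<tau>)) = B / \<rho> * (a\<^sub>0 * cos k\<^sub>0 + b\<^sub>0 * sin k\<^sub>0)"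
      "sinhc_sqrt (- \<tau>\<^sup>2) * (b \<tau> * cos (k \<tau>) - a \<tau> * sin (k \<tau>)) = B / \<rho> * (b\<^sub>0 * cos k\<^sub>0 - a\<^sub>0 * sin k\<^sub>0)"
      unfolding lS[symmetric] r a_def b_def by (simp_all add: algebra_simps)
  qed
  have coincide: "\<exists>s t. \<bar>s - t0\<bar> < d \<and> \<bar>t - t0\<bar> < d \<and> (k s, a s, b s) \<noteq> (k t, a t, b t) \<and>
        endpoint (k s) (a s) (b s) = endpoint (k t) (a t) (b t)" if "d > 0" for d
  proof -
    define \<sigma> where "\<sigma> = sgn (sin t0)"
    have "\<forall>\<^sub>F \<tau> in nhds t0. 0 < \<tau> \<and> 0 < \<sigma> * sin \<tau>"
    proof (rule eventually_conj)
      have "isCont (\<lambda>\<tau>. \<sigma> * sin \<tau>) t0" by (intro continuous_intros)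
      then have "((\<lambda>\<tau>. \<sigma> * sin \<tau>) \<longlongrightarrow> \<sigma> * sin t0) (nhds t0)"
        using tendsto_at_iff_tendsto_nhds[of "\<lambda>\<tau>. \<sigma> * sin \<tau>" t0] by (simp only: isCont_def)
      moreover have "0 < \<sigma> * sin t0" using sin_nz by (simp add: \<sigma>_def sgn_if)
      ultimately show "\<forall>\<^sub>F \<tau> in nhds t0. 0 < \<sigma> * sin \<tau>"
        by (rule order_tendstoD(1))
      show "\<forall>\<^sub>F \<tau> in nhds t0. 0 < \<tau>" using t0 order_tendstoD(1)[OF filterlim_ident] by blast
    qed
    then obtain e where e: "e > 0" "\<And>\<tau>. \<bar>\<tau> - t0\<bar> < e \<Longrightarrow> 0 < \<tau> \<and> 0 < \<sigma> * sin \<tau>"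
      by (auto simp: eventually_nhds_metric dist_real_def)
    have "\<exists>s t. \<bar>s - t0\<bar> < min d e \<and> \<bar>t - t0\<bar> < min d e \<and> s \<noteq> t \<and> angle \<kappa> B s = angle \<kappa> B t"
      by (rule angle_not_inj[OF crit \<kappa> B, of _ \<sigma>]) (use that e in auto)
    then obtain s t where *: "\<bar>s - t0\<bar> < min d e" "\<bar>t - t0\<bar> < min d e" "s \<noteq> t" "angle \<kappa> B s = angle \<kappa> B t"
      by blast
    have s: "0 < s" "sin s \<noteq> 0" and t: "0 < t" "sin t \<noteq> 0"
      using e(2)[of s] e(2)[of t] * by auto
    have nz: "s \<noteq> 0" "t \<noteq> 0" using s t by auto
    have "endpoint (k s) (a s) (b s) = endpoint (k t) (a t) (b t)"
      using end_angle[OF \<kappa> B s(2) nz(1)] end_angle[OF \<kappa> B t(2) nz(2)]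
      unfolding endpoint_eq ab2[OF s(2)] ab2[OF t(2)] k_def[symmetric] *(4)
        side[OF s(2) nz(1)] side[OF t(2) nz(2)]
      by simp
    moreover have "(k s, a s, b s) \<noteq> (k t, a t, b t)"
    proof
      assume "(k s, a s, b s) = (k t, a t, b t)"
      then have "k s = k t" "a s = a t" "b s = b t" by simp_all
      \<comment> \<open>The coordinates determine \<open>x\<close>, and \<open>x\<close> determines
        the positive parameter.\<close>
      then have "- s\<^sup>2 = - t\<^sup>2" unfolding ab2[OF s(2), symmetric] ab2[OF t(2), symmetric] by (simp only:)
      then show False using s(1) t(1) *(3) power2_eq_iff_nonneg[of s t] by simp
    qed
    ultimately show ?thesis using * by auto
  qed
  show ?thesis by (rule that[OF init(1) init' ck cab coincide])
qed

theorem proposition25: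
  fixes q p\<^sub>0 :: "real^2^2" and U :: "(real^2^2) set"
  assumes "q \<in> SL2"
    and "p\<^sub>0 \<in> conjugate_locus q"
    and "openin (top_of_set (cotangent_space SL2 q)) U"
    and "p\<^sub>0 \<in> U"
  shows "\<not> inj_on (sr_exp q) U"
proof -
  note not_inj = not_inj_on_sr_expI[OF assms(1,3,4)]
  define k a b where "k = mom0 q p\<^sub>0" and "a = mom1 q p\<^sub>0" and "b = mom2 q p\<^sub>0"
  note kab = k_def[symmetric] a_def[symmetric] b_def[symmetric]
  define x where "x = a\<^sup>2 + b\<^sup>2 - k\<^sup>2"
  consider (abnormal) "a = 0" "b = 0" | (circle) "a \<noteq> 0 \<or> b \<noteq> 0" "sinhc_sqrt x = 0"
    | (fold) "a \<noteq> 0 \<or> b \<noteq> 0" "sinhc_sqrt x \<noteq> 0" "sinhc_sqrt' x = 0"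
    using conjugate_locus_cases[OF assms(1,2)] unfolding kab x_def by blast
  then show ?thesis
  proof cases
    case abnormal
    \<comment> \<open>Here \<open>x = - t\<^sup>2\<close>, so \<open>C - i * t * S\<close> is
      \<open>exp (- i * t)\<close> and the rotation cancels it.\<close>
    have "endpoint t 0 0 = mat 1" for t
    proof -
      have "end1 t (- t\<^sup>2) = 1" "end2 t (- t\<^sup>2) = 0"
        unfolding end1_def end2_def cosh_sqrt_minus_square sinhc_sqrt_minus_square
        by (simp_all add: power2_eq_square[symmetric])
      then show ?thesis by (simp add: endpoint_eq mat2_one)
    qed
    moreover have "\<exists>s t. \<bar>s - k\<bar> < d \<and> \<bar>t - k\<bar> < d \<and> s \<noteq> t" if "d > 0" for d
      using that by (intro exI[of _ k] exI[of _ "k + d / 2"]) auto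
    ultimately show ?thesis
      using not_inj[of "\<lambda>t. t" k "\<lambda>_. 0" "\<lambda>_. 0"] abnormal unfolding kab by simp
  next
    case circle
    show ?thesis
    proof (rule not_inj[of "\<lambda>_. k" 0 "\<lambda>\<theta>. a * cos \<theta> - b * sin \<theta>" "\<lambda>\<theta>. a * sin \<theta> + b * cos \<theta>"])
      fix d :: real assume "d > 0"
      define \<theta> where "\<theta> = min (d / 2) 1"
      have \<theta>: "0 < \<theta>" "\<theta> < d" "\<theta> < pi" using \<open>d > 0\<close> pi_gt3 by (auto simp: \<theta>_def)
      have "(a * cos \<theta> - b * sin \<theta>, a * sin \<theta> + b * cos \<theta>) \<noteq> (a, b)"
      proof
        assume "(a * cos \<theta> - b * sin \<theta>, a * sin \<theta> + b * cos \<theta>) = (a, b)"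
        then have "a * cos \<theta> - b * sin \<theta> = a" "a * sin \<theta> + b * cos \<theta> = b" by simp_all
        \<comment> \<open>The cross product of \<open>(a, b)\<close> with its rotated copy isolates
          \<open>sin \<theta>\<close>.\<close>
        moreover have "(a\<^sup>2 + b\<^sup>2) * sin \<theta> =
            a * (a * sin \<theta> + b * cos \<theta>) - b * (a * cos \<theta> - b * sin \<theta>)"
          by (simp add: algebra_simps power2_eq_square)
        ultimately have "(a\<^sup>2 + b\<^sup>2) * sin \<theta> = 0" by simp
        moreover have "sin \<theta> > 0" using \<theta> by (intro sin_gt_zero)
        ultimately show False using circle(1) by (simp add: sum_power2_eq_zero_iff)
      qed
      \<comment> \<open>The rotation preserves \<open>x\<close>, hence \<alpha>, and \<beta> is zero
        because \<open>sinhc_sqrt x = 0\<close>.\<close>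
      moreover have "(a * cos \<theta> - b * sin \<theta>)\<^sup>2 + (a * sin \<theta> + b * cos \<theta>)\<^sup>2 - k\<^sup>2 = x"
        unfolding x_def rotate_norm ..
      then have "endpoint k (a * cos \<theta> - b * sin \<theta>) (a * sin \<theta> + b * cos \<theta>) = endpoint k a b"
        using circle(2) by (simp add: endpoint_eq x_def[symmetric])
      ultimately show "\<exists>s t. \<bar>s - 0\<bar> < d \<and> \<bar>t - 0\<bar> < d \<and>
        (k, a * cos s - b * sin s, a * sin s + b * cos s) \<noteq> (k, a * cos t - b * sin t, a * sin t + b * cos t) \<and>
        endpoint k (a * cos s - b * sin s) (a * sin s + b * cos s) = endpoint k (a * cos t - b * sin t) (a * sin t + b * cos t)"
        using \<theta> by (intro exI[of _ \<theta>] exI[of _ 0]) auto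
    qed (auto simp: kab intro!: continuous_intros)
  next
    case fold
    show ?thesis
    proof (rule fold_curve[OF fold(1) fold(2,3)[unfolded x_def]])
      fix k' a' b' :: "real \<Rightarrow> real" and t0
      assume "k' t0 = k" "a' t0 = a" "b' t0 = b" "isCont k' t0" "isCont a' t0" "isCont b' t0"
        "\<And>d. d > 0 \<Longrightarrow> \<exists>s t. \<bar>s - t0\<bar> < d \<and> \<bar>t - t0\<bar> < d \<and> (k' s, a' s, b' s) \<noteq> (k' t, a' t, b' t) \<and>
          endpoint (k' s) (a' s) (b' s) = endpoint (k' t) (a' t) (b' t)"
      then show ?thesis by (intro not_inj[of k' t0 a' b']) (simp_all only: kab)
    qed
  qed
qed

end
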